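(* Let $\beta_1,\ldots,\beta_d>0$. For every $0<\gamma\le1$, $$P\preceq_{s,\lambda_\beta,\gamma}^{\rm CSD}Q\quad\Longleftrightarrow\quad P\preceq_{\gamma,\beta}^{\rm MASD}Q,$$ and $$P\preceq_{\gamma,\beta}^{\rm MASD}Q\quad\Longleftrightarrow\quad\Delta_\beta(P,Q)\ge\frac{1-\gamma}{1+\gamma}\,W_{1,\beta}(P,Q).$$ Moreover, $$Q\text{ dominates }P\text{ by FOSD}\quad\Longleftrightarrow\quad\Delta_\beta(P,Q)=W_{1,\beta}(P,Q).$$
   Context: Let $D\subseteq\mathbb R^d$ be a nonempty Borel set; $P,Q$ are Borel probability measures supported on $D$ (i.e. $P(D)=Q(D)=1$) with finite first moments. $\mathcal C(P,Q)$ is the set of couplings of $P$ and $Q$ (first marginal $P$, second marginal $Q$), and $t_+:=\max\{t,0\}$. Coordinate-score CSD: with linear scores $s_a(x)=a\cdot x$, $a\in\mathbb R_+^d$, and $\lambda_\beta:=\sum_{i=1}^d\delta_{\beta_ie_i}$ ($e_i$ the unit vectors), $P\preceq_{s,\lambda_\beta,\gamma}^{\rm CSD}Q$ means that there exists $\kappa\in\mathcal C(P,Q)$ with $$\int_{D\times D}\sum_{i=1}^d\beta_i(x_i-y_i)_+\,\kappa(dx,dy)\le\gamma\int_{D\times D}\sum_{i=1}^d\beta_i(y_i-x_i)_+\,\kappa(dx,dy).$$ Substitution-MASD (multivariate almost stochastic dominance): for $0<\gamma\le1$, $P\preceq_{\gamma,\beta}^{\rm MASD}Q$ means $\int_D u\,dP\le\int_D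 u\,dQ$ for every differentiable $u:\mathbb R^d\to\mathbb R$ with $\gamma\beta_i\le\partial_iu(x)\le\beta_i$ for every $x\in\mathbb R^d$ and every $i$. $\Delta_\beta(P,Q):=\int_D\sum_i\beta_iy_i\,Q(dy)-\int_D\sum_i\beta_ix_i\,P(dx)$ is the weighted difference in coordinate means, and $W_{1,\beta}(P,Q):=\inf_{\kappa\in\mathcal C(P,Q)}\int_{D\times D}\sum_i\beta_i|x_i-y_i|\,\kappa(dx,dy)$ is the weighted $\ell_1$-Wasserstein distance. FOSD (multivariate first-order stochastic dominance): $Q$ dominates $P$ by FOSD if $P(A)\ge Q(A)$ for every closed lower set $A\subseteq\mathbb R^d$ (a set $A$ such that $x\in A$ and $y\le x$ coordinatewise imply $y\in A$). By Strassen's theorem (a known result) this is equivalent to the existence of $\kappa\in\mathcal C(P,Q)$ with $x\le y$ coordinatewise for $\kappa$-almost every $(x,y)$. *)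

theory Defs
  imports "HOL-Probability.Probability"
begin

definition couplings :: "'a::topological_space measure \<Rightarrow> 'a measure \<Rightarrow> ('a \<times> 'a) measure set"
  where "couplings P Q =
    {\<kappa>. sets \<kappa> = sets (borel \<Otimes>\<^sub>M borel) \<and> distr \<kappa> borel fst = P \<and> distr \<kappa> borel snd = Q}"

definition CSD :: "(real^'n) set \<Rightarrow> real \<Rightarrow> ('n \<Rightarrow> real) \<Rightarrow> (real^'n) measure \<Rightarrow> (real^'n) measure \<Rightarrow> bool"
  where "CSD D \<gamma> \<beta> P Q \<longleftrightarrow>
    (\<exists>\<kappa>\<in>couplings P Q.
      (LINT z:D \<times> D|\<kappa>. (\<Sum>i\<in>UNIV. \<beta> i * max (fst z $ i - snd z $ i) 0))
      \<le> \<gamma> * (LINT z:D \<times> D|\<kappa>. (\<Sum>i\<in>UNIV. \<beta> i * max (snd z $ i - fst z $ i) 0)))"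

definition partial_deriv :: "'n::finite \<Rightarrow> (real^'n \<Rightarrow> real) \<Rightarrow> real^'n \<Rightarrow> real"
  where "partial_deriv i u x = deriv (\<lambda>t. u (x + t *\<^sub>R axis i 1)) 0"

text \<open>The test functions below are Lipschitz, so under finite first moments both integrals exist.\<close>

definition MASD :: "(real^'n) set \<Rightarrow> real \<Rightarrow> ('n \<Rightarrow> real) \<Rightarrow> (real^'n) measure \<Rightarrow> (real^'n) measure \<Rightarrow> bool"
  where "MASD D \<gamma> \<beta> P Q \<longleftrightarrow>
    (\<forall>u :: real^'n \<Rightarrow> real.
      (\<forall>x. u differentiable (at x)) \<and>
      (\<forall>x i. \<gamma> * \<beta> i \<le> partial_deriv i u x \<and> partial_deriv i u x \<le> \<beta> i) \<longrightarrow>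
      (LINT x:D|P. u x) \<le> (LINT x:D|Q. u x))"

definition mean_diff :: "(real^'n) set \<Rightarrow> ('n \<Rightarrow> real) \<Rightarrow> (real^'n) measure \<Rightarrow> (real^'n) measure \<Rightarrow> real"
  where "mean_diff D \<beta> P Q =
    (LINT y:D|Q. (\<Sum>i\<in>UNIV. \<beta> i * y $ i)) - (LINT x:D|P. (\<Sum>i\<in>UNIV. \<beta> i * x $ i))"

text \<open>For probability measures with finite first moments the infimum is over a nonempty set of
  integrals of integrable nonnegative functions.\<close>

definition W1 :: "(real^'n) set \<Rightarrow> ('n \<Rightarrow> real) \<Rightarrow> (real^'n) measure \<Rightarrow> (real^'n) measure \<Rightarrow> real"
  where "W1 D \<beta> P Q =
    (INF \<kappa>\<in>couplings P Q. LINT z:D \<times> D|\<kappa>. (\<Sum>i\<in>UNIV. \<beta> i * \<bar>fst z $ i - snd z $ i\<bar>))"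

definition lower_set :: "'a::ord set \<Rightarrow> bool"
  where "lower_set A \<longleftrightarrow> (\<forall>x y. x \<in> A \<and> y \<le> x \<longrightarrow> y \<in> A)"

text \<open>\<open>FOSD P Q\<close> reads: \<open>Q\<close> dominates \<open>P\<close>. The order on vectors is the coordinatewise one.\<close>

definition FOSD :: "(real^'n) measure \<Rightarrow> (real^'n) measure \<Rightarrow> bool"
  where "FOSD P Q \<longleftrightarrow> (\<forall>A. closed A \<and> lower_set A \<longrightarrow> measure P A \<ge> measure Q A)"

end

theory Submission
  imports Defs "HOL-Library.Diagonal_Subsequence"
begin

text \<open>
  Since \<open>t\<^sub>+ = (\<bar>t\<bar> + t) / 2\<close>, the CSD inequality for a coupling \<open>\<kappa>\<close> says
  \<open>(1 - \<gamma>) I \<kappa> \<le> (1 + \<gamma>) \<Delta>\<close>, where \<open>I \<kappa>\<close> is the weighted \<open>l\<^sub>1\<close> transport cost. So CSD is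
  equivalent to the Wasserstein inequality as soon as the infimum defining \<open>W\<^sub>1\<close> is attained, and
  it implies MASD by the mean value theorem. The two remaining implications, from MASD and from
  FOSD, are Kantorovich-Rubinstein duality: writing \<open>b x\<close> for the weighted coordinate sum,
  a potential \<open>f\<close> that is 1-Lipschitz for the cost yields the MASD test function
  \<open>(1 + \<gamma>) / 2 * b - (1 - \<gamma>) / 2 * f\<close> (after smoothing) and the monotone function \<open>b - f\<close>.

  Duality is first shown for finitely supported measures, where the potential comes from cyclical
  monotonicity of an optimal matrix, and transferred to \<open>P\<close>, \<open>Q\<close> by spreading an optimal matrix
  over the level sets of a simple function close to the identity. The potential is then a minimum of
  finitely many cones, hence smoothed explicitly by a soft minimum. Attainment is compactness of the
  set of couplings, obtained from Kolmogorov's extension theorem.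
\<close>

text \<open>Attainment is shown on the primal side. On the dual side potentials that are optimal up
  to \<open>\<epsilon>\<close> suffice, because each inequality to be proved survives the limit
  \<open>\<epsilon>\<close> to 0; this leaves the freedom to choose a potential of a special shape.
  The freedom matters for MASD, whose test functions must have partial derivatives between
  \<open>\<gamma> * \<beta> i\<close> and \<open>\<beta> i\<close> without tolerance: a smoothing
  may perturb the values of the potential, but must keep its slopes within \<open>\<beta> i\<close>.
  The passage between \<open>P\<close>, \<open>Q\<close> and finite sets rests on one estimate:
  replacing \<open>x\<close> by \<open>F k x\<close> in the cost changes its integral by an amount
  bounded through the marginals alone. The error is therefore uniform over all couplings and tends
  to 0 by the first moments, so the coupling may vary first and \<open>F k\<close> be refined
  afterwards. For FOSD, \<open>\<Delta> \<le> W\<close> always holds since \<open>b\<close> is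
  itself 1-Lipschitz for the cost; in the case of equality an optimal coupling has almost surely
  cost \<open>b y - b x\<close>, which means \<open>x \<le> y\<close>.\<close>

lemma diagonal_convergent_subsequence:
  fixes f :: "nat \<Rightarrow> 'a \<Rightarrow> real"
  assumes S: "countable S" and bd: "\<And>n s. s \<in> S \<Longrightarrow> 0 \<le> f n s \<and> f n s \<le> 1"
  shows "\<exists>r. strict_mono (r :: nat \<Rightarrow> nat) \<and> (\<forall>s\<in>S. convergent (\<lambda>n. f (r n) s))"
proof (cases "S = {}")
  case True
  then show ?thesis using strict_mono_id by blast
next
  case False
  define e where "e = from_nat_into S"
  have e: "range e = S"
    unfolding e_def by (rule range_from_nat_into[OF False S])
  interpret d: subseqs "\<lambda>k s. convergent (\<lambda>n. f (s n) (e k))"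
  proof
    fix k and s :: "nat \<Rightarrow> nat"
    have "\<forall>n. f (s n) (e k) \<in> {0..1}"
      using bd e by auto
    then obtain l r where "strict_mono r" "((\<lambda>n. f (s n) (e k)) \<circ> r) \<longlonglongrightarrow> l"
      using compact_Icc compact_imp_seq_compact seq_compactE by metis
    then show "\<exists>r'. strict_mono r' \<and> convergent (\<lambda>n. f ((s \<circ> r') n) (e k))"
      by (auto simp: comp_def convergent_def)
  qed
  have "convergent (\<lambda>n. f (d.diagseq n) (e k))" for k
  proof -
    \<comment> \<open>The diagonal sequence is known to be a subsequence of the \<open>k\<close>-th
      extraction from index \<open>Suc k\<close> on; the shift is removed again below, as finitely
      many terms do not affect convergence.\<close>
    have "convergent (\<lambda>n. f ((d.diagseq \<circ> ((+) (Suc k))) n) (e k))"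
    proof (rule d.diagseq_holds)
      fix r s n assume "strict_mono (r :: nat \<Rightarrow> nat)" "convergent (\<lambda>i. f (s i) (e n))"
      then show "convergent (\<lambda>i. f ((s \<circ> r) i) (e n))"
        using convergent_subseq_convergent[of "\<lambda>i. f (s i) (e n)" r] by (simp add: comp_def)
    qed
    then have "convergent (\<lambda>n. f (d.diagseq (n + Suc k)) (e k))"
      by (simp add: comp_def add.commute)
    then show ?thesis
      using LIMSEQ_offset[of "\<lambda>n. f (d.diagseq n) (e k)" "Suc k"]
      unfolding convergent_def by blast
  qed
  then show ?thesis
    using d.subseq_diagseq e by blast
qed

section \<open>Duality for finite transport problems\<close>

definition transport_matrices :: "'a set \<Rightarrow> ('a \<Rightarrow> real) \<Rightarrow> ('a \<Rightarrow> real) \<Rightarrow> ('a \<Rightarrow> 'a \<Rightarrow> real) set"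
  where "transport_matrices A p q =
    {m. (\<forall>a b. 0 \<le> m a b) \<and> (\<forall>a\<in>A. (\<Sum>b\<in>A. m a b) = p a) \<and> (\<forall>b\<in>A. (\<Sum>a\<in>A. m a b) = q b)}"

definition matrix_cost :: "'a set \<Rightarrow> ('a \<Rightarrow> 'a \<Rightarrow> real) \<Rightarrow> ('a \<Rightarrow> 'a \<Rightarrow> real) \<Rightarrow> real"
  where "matrix_cost A c m = (\<Sum>a\<in>A. \<Sum>b\<in>A. m a b * c a b)"

text \<open>Entries are bounded by the row mass, hence by 1, so a minimizing sequence has an
  entrywise convergent subsequence. Marginals and cost are finite sums of entries and pass to the
  limit.\<close>

lemma optimal_matrix_exists:
  assumes A: "finite A" and p: "\<And>a. 0 \<le> p a" "sum p A = 1" and q: "\<And>a. 0 \<le> q a" "sum q A = 1"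
    and c: "\<And>x y. 0 \<le> c x y"
  shows "\<exists>m\<in>transport_matrices A p q. \<forall>m'\<in>transport_matrices A p q. matrix_cost A c m \<le> matrix_cost A c m'"
proof -
  let ?T = "transport_matrices A p q"
  define I where "I = (INF m\<in>?T. matrix_cost A c m)"
  have ne: "(\<lambda>a b. p a * q b) \<in> ?T"
    using p q by (auto simp: transport_matrices_def sum_distrib_left[symmetric] sum_distrib_right[symmetric])
  have nonneg: "0 \<le> matrix_cost A c m" if "m \<in> ?T" for m
    using that c by (auto simp: transport_matrices_def matrix_cost_def intro!: sum_nonneg mult_nonneg_nonneg)
  have bdd: "bdd_below (matrix_cost A c ` ?T)"
    using nonneg by (auto intro!: bdd_belowI[of _ 0])
  have "\<exists>m. m \<in> ?T \<and> matrix_cost A c m < I + 1 / real (Suc n)" for n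
    using cINF_less_iff[OF _ bdd, of "I + 1 / real (Suc n)"] ne unfolding I_def[symmetric] by force
  then obtain m where mT: "\<And>n. m n \<in> ?T" and mI: "\<And>n. matrix_cost A c (m n) < I + 1 / real (Suc n)"
    by metis
  have le1: "m n a b \<le> 1" if "a \<in> A" "b \<in> A" for n a b
  proof -
    have "m n a b \<le> (\<Sum>b\<in>A. m n a b)"
      using mT[of n] A that by (intro member_le_sum) (auto simp: transport_matrices_def)
    also have "\<dots> = p a" using mT[of n] that by (auto simp: transport_matrices_def)
    also have "\<dots> \<le> sum p A" using p A that by (intro member_le_sum) auto
    finally show ?thesis using p by simp
  qed
  have pos: "0 \<le> m n a b" for n a b using mT[of n] by (auto simp: transport_matrices_def)
  have "\<exists>r. strict_mono (r :: nat \<Rightarrow> nat) \<and> (\<forall>s\<in>A\<times>A. convergent (\<lambda>n. case s of (a,b) \<Rightarrow> m (r n) a b))"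
    by (rule diagonal_convergent_subsequence) (use A pos le1 in \<open>auto intro: countable_finite\<close>)
  then obtain r where r: "strict_mono (r::nat\<Rightarrow>nat)" and
      cv: "\<And>a b. a \<in> A \<Longrightarrow> b \<in> A \<Longrightarrow> convergent (\<lambda>n. m (r n) a b)"
    by fastforce
  \<comment> \<open>The value 0 outside \<open>A\<close> keeps the nonnegativity that
    \<open>transport_matrices\<close> demands of all entries; marginals and cost only see entries
    inside.\<close>
  define m0 where "m0 a b = (if a \<in> A \<and> b \<in> A then lim (\<lambda>n. m (r n) a b) else 0)" for a b
  have lim: "(\<lambda>n. m (r n) a b) \<longlonglongrightarrow> m0 a b" if "a \<in> A" "b \<in> A" for a b
    using cv[OF that] that by (simp add: m0_def convergent_LIMSEQ_iff)
  have "m0 \<in> ?T"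
    unfolding transport_matrices_def
  proof (intro CollectI conjI allI ballI)
    fix a b show "0 \<le> m0 a b"
      using LIMSEQ_le_const[OF lim, of a b 0] pos by (cases "a \<in> A \<and> b \<in> A") (auto simp: m0_def)
  next
    fix a assume a: "a \<in> A"
    have "(\<lambda>n. \<Sum>b\<in>A. m (r n) a b) \<longlonglongrightarrow> (\<Sum>b\<in>A. m0 a b)"
      using lim a by (intro tendsto_sum) auto
    moreover have "(\<lambda>n. \<Sum>b\<in>A. m (r n) a b) = (\<lambda>n. p a)"
      using mT a by (auto simp: transport_matrices_def)
    ultimately show "(\<Sum>b\<in>A. m0 a b) = p a"
      using LIMSEQ_unique tendsto_const by metis
  next
    fix b assume b: "b \<in> A"
    have "(\<lambda>n. \<Sum>a\<in>A. m (r n) a b) \<longlonglongrightarrow> (\<Sum>a\<in>A. m0 a b)"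
      using lim b by (intro tendsto_sum) auto
    moreover have "(\<lambda>n. \<Sum>a\<in>A. m (r n) a b) = (\<lambda>n. q b)"
      using mT b by (auto simp: transport_matrices_def)
    ultimately show "(\<Sum>a\<in>A. m0 a b) = q b"
      using LIMSEQ_unique tendsto_const by metis
  qed
  moreover have "matrix_cost A c m0 \<le> I"
  proof (rule LIMSEQ_le)
    show "(\<lambda>n. matrix_cost A c (m (r n))) \<longlonglongrightarrow> matrix_cost A c m0"
      unfolding matrix_cost_def using lim by (intro tendsto_sum tendsto_mult tendsto_const) auto
    have "(\<lambda>n. I + 1 / real (Suc n)) \<longlonglongrightarrow> I + 0"
      by (intro tendsto_add tendsto_const LIMSEQ_Suc[OF lim_1_over_n])
    then show "(\<lambda>n. I + 1 / real (Suc (r n))) \<longlonglongrightarrow> I"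
      using LIMSEQ_subseq_LIMSEQ[OF _ r, of "\<lambda>n. I + 1 / real (Suc n)" I] by (simp add: comp_def)
    show "\<exists>N. \<forall>n\<ge>N. matrix_cost A c (m (r n)) \<le> I + 1 / real (Suc (r n))"
      using mI less_imp_le by blast
  qed
  ultimately show ?thesis
    unfolding I_def using cINF_lower[OF bdd] by force
qed

text \<open>Moving a small mass from the entries \<open>(a i, b i)\<close> to the entries \<open>(a i, b (\<sigma> i))\<close> preserves
  both marginals, so it cannot lower the cost.\<close>

lemma optimal_matrix_cyclically_monotone:
  fixes a b :: "nat \<Rightarrow> 'a"
  assumes A: "finite A" and m: "m \<in> transport_matrices A p q"
    and opt: "\<And>m'. m' \<in> transport_matrices A p q \<Longrightarrow> matrix_cost A c m \<le> matrix_cost A c m'"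
    and ab: "\<And>i. i < N \<Longrightarrow> a i \<in> A \<and> b i \<in> A \<and> 0 < m (a i) (b i)"
    and \<sigma>: "bij_betw \<sigma> {..<N} {..<N}"
  shows "(\<Sum>i<N. c (a i) (b i)) \<le> (\<Sum>i<N. c (a i) (b (\<sigma> i)))"
proof (cases "N = 0")
  case False
  define M where "M = Min ((\<lambda>i. m (a i) (b i)) ` {..<N})"
  \<comment> \<open>A pair may occur at several of the \<open>N\<close> positions; \<open>u\<close>
    and \<open>v\<close> below count multiplicities. Since \<open>v\<close> is at most
    \<open>N\<close>, and 0 off the listed pairs, subtracting \<open>\<epsilon> * v\<close> leaves
    every entry nonnegative.\<close>
  define \<epsilon> where "\<epsilon> = M / real N"
  have "0 < M" unfolding M_def using False ab by (subst Min_gr_iff) auto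
  then have \<epsilon>: "0 < \<epsilon>" using False by (simp add: \<epsilon>_def)
  define u where "u x y = (\<Sum>i<N. of_bool (x = a i) * of_bool (y = b (\<sigma> i)) :: real)" for x y
  define v where "v x y = (\<Sum>i<N. of_bool (x = a i) * of_bool (y = b i) :: real)" for x y
  define m' where "m' x y = m x y + \<epsilon> * (u x y - v x y)" for x y
  have \<sigma>N: "\<sigma> i < N" if "i < N" for i using \<sigma> that by (auto simp: bij_betw_def)
  have bool_sum: "(\<Sum>x\<in>A. g x * of_bool (x = z)) = g z" if "z \<in> A" for z and g :: "'a \<Rightarrow> real"
    using A that by (simp add: of_bool_def if_distrib sum.delta' cong: if_cong)
  have bool_sum': "(\<Sum>x\<in>A. of_bool (x = z) * t) = t" if "z \<in> A" for z and t :: real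
    using bool_sum[OF that, of "\<lambda>_. t"] by (simp add: mult.commute)
  have row: "(\<Sum>y\<in>A. \<Sum>i<N. of_bool (x = a i) * of_bool (y = d i) :: real) = (\<Sum>i<N. of_bool (x = a i))"
    if "\<And>i. i < N \<Longrightarrow> d i \<in> A" for x d
    by (subst sum.swap) (rule sum.cong[OF refl], rule bool_sum, use that in auto)
  have column: "(\<Sum>x\<in>A. \<Sum>i<N. of_bool (x = a i) * of_bool (y = d i) :: real) = (\<Sum>i<N. of_bool (y = d i))"
    for y d
    by (subst sum.swap) (rule sum.cong[OF refl], rule bool_sum', use ab in auto)
  have u1: "(\<Sum>y\<in>A. u x y) = (\<Sum>i<N. of_bool (x = a i))" for x
    unfolding u_def using ab \<sigma>N by (intro row) auto
  have v1: "(\<Sum>y\<in>A. v x y) = (\<Sum>i<N. of_bool (x = a i))" for x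
    unfolding v_def using ab by (intro row) auto
  \<comment> \<open>Bijectivity of \<open>\<sigma>\<close> enters here: it merely reorders the
    targets, so each column gains through \<open>u\<close> what it loses through
    \<open>v\<close>.\<close>
  have u2: "(\<Sum>x\<in>A. u x y) = (\<Sum>i<N. of_bool (y = b i))" for y
    unfolding u_def column by (rule sum.reindex_bij_betw[OF \<sigma>])
  have v2: "(\<Sum>x\<in>A. v x y) = (\<Sum>i<N. of_bool (y = b i))" for y
    unfolding v_def by (rule column)
  have cost: "(\<Sum>x\<in>A. \<Sum>y\<in>A. (\<Sum>i<N. of_bool (x = a i) * of_bool (y = d i)) * c x y) = (\<Sum>i<N. c (a i) (d i))"
    if "\<And>i. i < N \<Longrightarrow> d i \<in> A" for d
  proof -
    have "(\<Sum>x\<in>A. \<Sum>y\<in>A. (\<Sum>i<N. of_bool (x = a i) * of_bool (y = d i)) * c x y) =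
      (\<Sum>i<N. \<Sum>x\<in>A. (\<Sum>y\<in>A. c x y * of_bool (y = d i)) * of_bool (x = a i))"
      unfolding sum_distrib_right
      by (subst sum.swap[of _ A "{..<N}"], subst (2) sum.swap) (simp add: mult_ac)
    also have "\<dots> = (\<Sum>i<N. c (a i) (d i))"
      using ab that by (intro sum.cong) (auto simp: bool_sum)
    finally show ?thesis .
  qed
  have "m' \<in> transport_matrices A p q"
    unfolding transport_matrices_def
  proof (intro CollectI conjI allI ballI)
    fix x y
    have u0: "0 \<le> u x y" unfolding u_def by (intro sum_nonneg) auto
    have "\<epsilon> * v x y \<le> m x y"
    proof (cases "\<exists>i<N. x = a i \<and> y = b i")
      case True
      then obtain i where i: "i < N" "x = a i" "y = b i" by blast
      have "v x y \<le> (\<Sum>i<N. 1)" unfolding v_def by (intro sum_mono) auto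
      then have "\<epsilon> * v x y \<le> \<epsilon> * real N" using \<epsilon> by simp
      also have "\<dots> = M" using False by (simp add: \<epsilon>_def)
      also have "\<dots> \<le> m x y" unfolding M_def i by (rule Min_le) (use i in auto)
      finally show ?thesis .
    next
      case False
      then have "v x y = 0" unfolding v_def by (intro sum.neutral) auto
      then show ?thesis using m by (simp add: transport_matrices_def)
    qed
    moreover have "0 \<le> \<epsilon> * u x y" using u0 \<epsilon> by simp
    ultimately show "0 \<le> m' x y" by (simp add: m'_def algebra_simps)
  next
    fix x assume "x \<in> A"
    then show "(\<Sum>y\<in>A. m' x y) = p x"
      using m by (simp add: m'_def transport_matrices_def sum.distrib sum_distrib_left[symmetric] sum_subtractf u1 v1)
  next
    fix y assume "y \<in> A"
    then show "(\<Sum>x\<in>A. m' x y) = q y"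
      using m by (simp add: m'_def transport_matrices_def sum.distrib sum_distrib_left[symmetric] sum_subtractf u2 v2)
  qed
  then have "matrix_cost A c m \<le> matrix_cost A c m'" by (rule opt)
  also have "matrix_cost A c m' = matrix_cost A c m +
      \<epsilon> * ((\<Sum>x\<in>A. \<Sum>y\<in>A. u x y * c x y) - (\<Sum>x\<in>A. \<Sum>y\<in>A. v x y * c x y))"
    by (simp add: matrix_cost_def m'_def algebra_simps sum.distrib sum_subtractf sum_distrib_left)
  also have "(\<Sum>x\<in>A. \<Sum>y\<in>A. u x y * c x y) = (\<Sum>i<N. c (a i) (b (\<sigma> i)))"
    unfolding u_def using ab \<sigma>N by (intro cost) auto
  also have "(\<Sum>x\<in>A. \<Sum>y\<in>A. v x y * c x y) = (\<Sum>i<N. c (a i) (b i))"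
    unfolding v_def using ab by (intro cost) auto
  finally show ?thesis using \<epsilon> by (simp add: zero_le_mult_iff)
qed simp

text \<open>The potential is 1-Lipschitz for \<open>c\<close> and increases by exactly
  \<open>c a b\<close> on the support of an optimal matrix. Hence
  \<open>m a b * c a b = m a b * (f b - f a)\<close> on \<open>A\<close>, and summing separates the
  two marginals. The triangle inequality and \<open>c x x = 0\<close> allow one function in place of
  a pair of potentials.\<close>

lemma finite_kantorovich_duality:
  fixes c :: "'a \<Rightarrow> 'a \<Rightarrow> real"
  assumes A: "finite A" and p: "\<And>a. 0 \<le> p a" "sum p A = 1" and q: "\<And>a. 0 \<le> q a" "sum q A = 1"
    and c0: "\<And>x y. 0 \<le> c x y" and c_refl: "\<And>x. c x x = 0"
    and c_tri: "\<And>x y z. c x z \<le> c x y + c y z"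
  shows "\<exists>m\<in>transport_matrices A p q. \<exists>f. (\<forall>x y. f y - f x \<le> c x y) \<and>
    matrix_cost A c m = (\<Sum>a\<in>A. f a * q a) - (\<Sum>a\<in>A. f a * p a)"
proof -
  obtain m where m: "m \<in> transport_matrices A p q"
    and opt: "\<And>m'. m' \<in> transport_matrices A p q \<Longrightarrow> matrix_cost A c m \<le> matrix_cost A c m'"
    using optimal_matrix_exists[where A = A and p = p and q = q and c = c] A p q c0 by blast
  have m_nonneg: "0 \<le> m a b" for a b using m by (auto simp: transport_matrices_def)
  define S where "S = {z. fst z \<in> A \<and> snd z \<in> A \<and> 0 < m (fst z) (snd z)}"
  have "S \<noteq> {}"
  proof
    assume "S = {}"
    then have "\<not> 0 < m a b" if "a \<in> A" "b \<in> A" for a b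
      using that by (auto simp: S_def)
    then have "m a b = 0" if "a \<in> A" "b \<in> A" for a b
      using that m_nonneg[of a b] by force
    then have "p a = 0" if "a \<in> A" for a
      using m that by (auto simp: transport_matrices_def)
    then show False using p by simp
  qed
  then obtain z0 where z0: "z0 \<in> S" by blast
  \<comment> \<open>Rockafellar's construction: the infimum of the alternating costs along chains in the support.\<close>
  define chains where "chains = {(N :: nat, s). s 0 = z0 \<and> (\<forall>i\<le>N. s i \<in> S)}"
  define val where "val N s y = (\<Sum>i<N. c (fst (s i)) (snd (s (Suc i)))) -
    (\<Sum>i<Suc N. c (fst (s i)) (snd (s i))) + c (fst (s N)) y" for N and s :: "nat \<Rightarrow> 'a \<times> 'a" and y
  \<comment> \<open>At \<open>snd z0\<close> the chain closes up to a cycle through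
    \<open>Suc N\<close> pairs; \<open>\<sigma>\<close> is the cyclic shift of their indices, so
    cyclical monotonicity applies.\<close>
  have val_loop: "0 \<le> val N s (snd z0)" if "(N, s) \<in> chains" for N s
  proof -
    define \<sigma> where "\<sigma> i = (if i = N then 0 else Suc i)" for i
    have "bij_betw \<sigma> {..<Suc N} {..<Suc N}"
      by (rule bij_betw_byWitness[where f' = "\<lambda>i. if i = 0 then N else i - 1"]) (auto simp: \<sigma>_def)
    then have "(\<Sum>i<Suc N. c (fst (s i)) (snd (s i))) \<le> (\<Sum>i<Suc N. c (fst (s i)) (snd (s (\<sigma> i))))"
      using that by (intro optimal_matrix_cyclically_monotone[OF A m opt]) (auto simp: chains_def S_def)
    also have "\<dots> = (\<Sum>i<N. c (fst (s i)) (snd (s (Suc i)))) + c (fst (s N)) (snd z0)"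
      using that by (simp add: \<sigma>_def chains_def)
    finally show ?thesis by (simp add: val_def)
  qed
  have val_lip: "val N s y \<le> val N s x + c x y" for N s x y
    using c_tri[of "fst (s N)" y x] by (simp add: val_def)
  define f where "f y = (INF (N, s)\<in>chains. val N s y)" for y
  have chains_ne: "chains \<noteq> {}"
  proof -
    have "(0, \<lambda>_. z0) \<in> chains" using z0 by (simp add: chains_def)
    then show ?thesis by blast
  qed
  \<comment> \<open>Nonnegativity on closed chains bounds the values at every \<open>y\<close> from
    below, at the price of \<open>c y (snd z0)\<close>; so the infimum \<open>f\<close> is a genuine
    one.\<close>
  have bdd: "bdd_below ((\<lambda>(N, s). val N s y) ` chains)" for y
  proof (intro bdd_belowI[of _ "- c y (snd z0)"])
    fix v assume "v \<in> (\<lambda>(N, s). val N s y) ` chains"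
    then obtain N s where "(N, s) \<in> chains" "v = val N s y" by auto
    then show "- c y (snd z0) \<le> v" using val_loop[of N s] val_lip[of N s "snd z0" y] by simp
  qed
  have f_le: "f y \<le> val N s y" if "(N, s) \<in> chains" for N s y
    unfolding f_def using cINF_lower[OF bdd that] by simp
  have f_ge: "t \<le> f y" if "\<And>N s. (N, s) \<in> chains \<Longrightarrow> t \<le> val N s y" for t y
    unfolding f_def using chains_ne that by (intro cINF_greatest) auto
  have lip: "f y - f x \<le> c x y" for x y
  proof -
    have "f y - c x y \<le> f x"
    proof (rule f_ge)
      fix N s assume "(N, s) \<in> chains"
      then show "f y - c x y \<le> val N s x" using f_le[of N s y] val_lip[of N s y x] by simp
    qed
    then show ?thesis by simp
  qed
  \<comment> \<open>Appending \<open>(a, b)\<close> to a chain adds the crossed term into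
    \<open>b\<close>, subtracts \<open>c a b\<close>, and ends with \<open>c a a = 0\<close>. So
    every value at \<open>b\<close> exceeds some value at \<open>a\<close> by \<open>c a b\<close>;
    the Lipschitz bound gives the other inequality.\<close>
  have tight: "f b - f a = c a b" if "(a, b) \<in> S" for a b
  proof -
    have "f a + c a b \<le> f b"
    proof (rule f_ge)
      fix N s assume s: "(N, s) \<in> chains"
      define s' where "s' = s(Suc N := (a, b))"
      have "(Suc N, s') \<in> chains"
        using s that by (auto simp: chains_def s'_def le_Suc_eq)
      then have "f a \<le> val (Suc N) s' a" by (rule f_le)
      also have "(\<Sum>i<N. c (fst (s' i)) (snd (s' (Suc i)))) = (\<Sum>i<N. c (fst (s i)) (snd (s (Suc i))))"
        by (intro sum.cong) (auto simp: s'_def)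
      moreover have "(\<Sum>i<N. c (fst (s' i)) (snd (s' i))) = (\<Sum>i<N. c (fst (s i)) (snd (s i)))"
        by (intro sum.cong) (auto simp: s'_def)
      ultimately have "f a \<le> val N s b - c a b"
        by (simp add: val_def) (simp add: s'_def c_refl)
      then show "f a + c a b \<le> val N s b" by simp
    qed
    then show ?thesis using lip[of b a] by simp
  qed
  have "matrix_cost A c m = (\<Sum>a\<in>A. \<Sum>b\<in>A. m a b * (f b - f a))"
    unfolding matrix_cost_def
  proof (intro sum.cong refl)
    fix a b assume "a \<in> A" "b \<in> A"
    then show "m a b * c a b = m a b * (f b - f a)"
      using tight[of a b] m_nonneg[of a b] by (cases "m a b = 0") (auto simp: S_def)
  qed
  also have "\<dots> = (\<Sum>a\<in>A. \<Sum>b\<in>A. f b * m a b) - (\<Sum>a\<in>A. \<Sum>b\<in>A. f a * m a b)"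
    by (simp add: algebra_simps sum_subtractf)
  also have "(\<Sum>a\<in>A. \<Sum>b\<in>A. f b * m a b) = (\<Sum>b\<in>A. f b * q b)"
    using m by (subst sum.swap) (simp add: sum_distrib_left[symmetric] transport_matrices_def)
  also have "(\<Sum>a\<in>A. \<Sum>b\<in>A. f a * m a b) = (\<Sum>b\<in>A. f b * p b)"
    using m by (simp add: sum_distrib_left[symmetric] transport_matrices_def)
  finally show ?thesis using m lip by blast
qed

section \<open>Simple functions close to the identity\<close>

lemma integral_finite_range:
  fixes g :: "'b \<Rightarrow> real"
  assumes "finite_measure M" and B: "finite B" and G: "\<And>z. z \<in> space M \<Longrightarrow> G z \<in> B"
    and meas: "\<And>b. b \<in> B \<Longrightarrow> {z\<in>space M. G z = b} \<in> sets M"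
  shows "integrable M (\<lambda>z. g (G z))"
    and "(LINT z|M. g (G z)) = (\<Sum>b\<in>B. g b * measure M {z\<in>space M. G z = b})"
proof -
  interpret finite_measure M by fact
  have eq: "g (G z) = (\<Sum>b\<in>B. g b * indicator {z\<in>space M. G z = b} z)" if "z \<in> space M" for z
    using G[OF that] B that by (simp add: indicator_def if_distrib sum.delta' cong: if_cong)
  have int: "integrable M (\<lambda>z. g b * indicator {z\<in>space M. G z = b} z)" if "b \<in> B" for b
    using meas[OF that] by (intro integrable_mult_right integrable_real_indicator) (auto simp: less_top[symmetric])
  show "integrable M (\<lambda>z. g (G z))"
    using int by (subst Bochner_Integration.integrable_cong[OF refl eq]) auto
  show "(LINT z|M. g (G z)) = (\<Sum>b\<in>B. g b * measure M {z\<in>space M. G z = b})"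
    using int meas by (subst Bochner_Integration.integral_cong[OF refl eq]) (auto intro!: sum.cong)
qed

lemma simple_approximation_of_identity:
  obtains F :: "nat \<Rightarrow> 'a::euclidean_space \<Rightarrow> 'a"
  where "\<And>k. F k \<in> borel_measurable borel" "\<And>k. finite (range (F k))"
    "\<And>x. (\<lambda>k. F k x) \<longlonglongrightarrow> x" "\<And>k x. norm (F k x) \<le> 2 * norm x"
proof -
  obtain F :: "nat \<Rightarrow> 'a \<Rightarrow> 'a" where "\<And>k. simple_function borel (F k)"
      "\<And>x. (\<lambda>k. F k x) \<longlonglongrightarrow> x" "\<And>k x. dist (F k x) 0 \<le> 2 * dist x 0"
    using borel_measurable_implies_sequence_metric[of "\<lambda>x. x" "borel :: 'a measure" 0] by auto
  then show ?thesis
    using that[of F] by (auto simp: borel_measurable_simple_function simple_function_def)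
qed

text \<open>Dominated convergence with majorant \<open>3 * norm x\<close>: 2 from the bound on the
  approximation, 1 from the identity.\<close>

lemma approximation_of_identity_L1:
  fixes F :: "nat \<Rightarrow> 'a::euclidean_space \<Rightarrow> 'a"
  assumes "sets M = sets borel" and int: "integrable M norm"
    and F[measurable]: "\<And>k. F k \<in> borel_measurable borel"
    and lim: "\<And>x. (\<lambda>k. F k x) \<longlonglongrightarrow> x" and bd: "\<And>k x. norm (F k x) \<le> 2 * norm x"
  shows "(\<lambda>k. LINT x|M. norm (F k x - x)) \<longlonglongrightarrow> 0"
proof -
  have [measurable_cong]: "sets M = sets borel" by fact
  have "(\<lambda>k. LINT x|M. norm (F k x - x)) \<longlonglongrightarrow> (LINT x|M. 0)"
  proof (rule integral_dominated_convergence[where w="\<lambda>x. 3 * norm x"])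
    show "integrable M (\<lambda>x. 3 * norm x)" using int by simp
    show "AE x in M. (\<lambda>k. norm (F k x - x)) \<longlonglongrightarrow> 0"
      using lim by (auto intro!: tendsto_norm_zero simp: LIM_zero_iff)
    show "AE x in M. norm (norm (F k x - x)) \<le> 3 * norm x" for k
    proof (intro AE_I2)
      fix x show "norm (norm (F k x - x)) \<le> 3 * norm x"
        using norm_triangle_ineq4[of "F k x" x] bd[of k x] by simp
    qed
  qed measurable
  then show ?thesis by simp
qed

section \<open>Couplings with fixed marginals\<close>

locale marginals =
  fixes P Q :: "'a::euclidean_space measure"
  assumes prob_P: "prob_space P" and prob_Q: "prob_space Q"
    and sets_P[measurable_cong]: "sets P = sets borel" and sets_Q[measurable_cong]: "sets Q = sets borel"
    and moment_P: "integrable P norm" and moment_Q: "integrable Q norm"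
begin

sublocale P: prob_space P by (rule prob_P)
sublocale Q: prob_space Q by (rule prob_Q)

lemma space_P[simp]: "space P = UNIV" using sets_eq_imp_space_eq[OF sets_P] by simp
lemma space_Q[simp]: "space Q = UNIV" using sets_eq_imp_space_eq[OF sets_Q] by simp

lemma sets_coupling: "\<kappa> \<in> couplings P Q \<Longrightarrow> sets \<kappa> = sets (borel \<Otimes>\<^sub>M borel)"
  by (simp add: couplings_def)

lemma space_coupling: "\<kappa> \<in> couplings P Q \<Longrightarrow> space \<kappa> = UNIV"
  using sets_eq_imp_space_eq[OF sets_coupling] by (simp add: space_pair_measure)

lemma prob_space_coupling:
  assumes "\<kappa> \<in> couplings P Q" shows "prob_space \<kappa>"
proof (rule prob_space_distrD)
  have [measurable_cong]: "sets \<kappa> = sets (borel \<Otimes>\<^sub>M borel)" using assms by (rule sets_coupling)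
  show "fst \<in> \<kappa> \<rightarrow>\<^sub>M borel" by measurable
  show "prob_space (distr \<kappa> borel fst)" using assms prob_P by (simp add: couplings_def)
qed

lemma
  fixes f :: "'a \<Rightarrow> real"
  assumes \<kappa>: "\<kappa> \<in> couplings P Q" and [measurable]: "f \<in> borel_measurable borel"
  shows integrable_coupling_fst: "integrable \<kappa> (\<lambda>z. f (fst z)) \<longleftrightarrow> integrable P f"
    and integrable_coupling_snd: "integrable \<kappa> (\<lambda>z. f (snd z)) \<longleftrightarrow> integrable Q f"
    and integral_coupling_fst: "(LINT z|\<kappa>. f (fst z)) = (LINT x|P. f x)"
    and integral_coupling_snd: "(LINT z|\<kappa>. f (snd z)) = (LINT x|Q. f x)"
proof -
  have [measurable_cong]: "sets \<kappa> = sets (borel \<Otimes>\<^sub>M borel)" using \<kappa> by (rule sets_coupling)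
  have *: "P = distr \<kappa> borel fst" "Q = distr \<kappa> borel snd" using \<kappa> by (auto simp: couplings_def)
  show "integrable \<kappa> (\<lambda>z. f (fst z)) \<longleftrightarrow> integrable P f" "(LINT z|\<kappa>. f (fst z)) = (LINT x|P. f x)"
    unfolding *(1) by (auto simp: integrable_distr_eq integral_distr)
  show "integrable \<kappa> (\<lambda>z. f (snd z)) \<longleftrightarrow> integrable Q f" "(LINT z|\<kappa>. f (snd z)) = (LINT x|Q. f x)"
    unfolding *(2) by (auto simp: integrable_distr_eq integral_distr)
qed

text \<open>Given the classes \<open>F x = a\<close> and \<open>F y = b\<close>, which receive the mass \<open>m a b\<close>, the two coordinates
  are taken independent.\<close>

lemma coupling_from_matrix:
  assumes [measurable]: "F \<in> borel_measurable borel" and fin: "finite (range F)"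
    and m: "m \<in> transport_matrices (range F) (\<lambda>a. measure P (F -` {a})) (\<lambda>a. measure Q (F -` {a}))"
  shows "\<exists>\<kappa>\<in>couplings P Q. \<forall>h :: 'a \<Rightarrow> 'a \<Rightarrow> real.
    (LINT z|\<kappa>. h (F (fst z)) (F (snd z))) = matrix_cost (range F) h m"
proof -
  let ?A = "range F"
  define p where "p a = measure P (F -` {a})" for a
  define q where "q a = measure Q (F -` {a})" for a
  have lev[measurable]: "F -` {a} \<in> sets borel" for a
    using measurable_sets[OF assms(1), of "{a}"] by simp
  have level: "{z \<in> UNIV. F z = a} = F -` {a}" for a by auto
  have m0: "0 \<le> m a b" for a b using m by (simp add: transport_matrices_def)
  have row: "(\<Sum>b\<in>?A. m a b) = p a" if "a \<in> ?A" for a using m that by (auto simp: transport_matrices_def p_def)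
  have col: "(\<Sum>a\<in>?A. m a b) = q b" if "b \<in> ?A" for b using m that by (auto simp: transport_matrices_def q_def)
  have mp: "m a b = 0" if "a \<in> ?A" "b \<in> ?A" "p a = 0" for a b
    using row[of a] that m0 fin by (auto simp: sum_nonneg_eq_0_iff)
  have mq: "m a b = 0" if "a \<in> ?A" "b \<in> ?A" "q b = 0" for a b
    using col[of b] that m0 fin by (auto simp: sum_nonneg_eq_0_iff)
  have p0: "0 \<le> p a" "0 \<le> q a" for a by (auto simp: p_def q_def)
  \<comment> \<open>The density of the coupling with respect to the product measure, constant on
    products of level sets. If \<open>p a\<close> or \<open>q b\<close> is 0, the quotient is 0 by
    convention, in agreement with \<open>m a b = 0\<close> there.\<close>
  define d where "d a b = m a b / (p a * q b)" for a b
  have d0: "0 \<le> d a b" for a b using m0 p0 by (simp add: d_def)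
  have dpq: "d a b * (p a * q b) = m a b" if "a \<in> ?A" "b \<in> ?A" for a b
    using mp[OF that] mq[OF that] by (auto simp: d_def)
  have d_eq: "d (F x) (F y) = (\<Sum>a\<in>?A. \<Sum>b\<in>?A. d a b * (indicator (F -` {a}) x * indicator (F -` {b}) y))" for x y
  proof -
    have "(\<Sum>a\<in>?A. \<Sum>b\<in>?A. d a b * (indicator (F -` {a}) x * indicator (F -` {b}) y)) =
      (\<Sum>a\<in>?A. if F x = a then (\<Sum>b\<in>?A. if F y = b then d a b else 0) else 0)"
      by (intro sum.cong refl) (auto simp: indicator_def intro!: sum.cong)
    then show ?thesis using fin by simp
  qed
  have d_meas[measurable]: "(\<lambda>z. d (F (fst z)) (F (snd z))) \<in> borel_measurable (borel \<Otimes>\<^sub>M borel)"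
    unfolding d_eq by measurable
  interpret PQ: pair_prob_space P Q ..
  define \<kappa> where "\<kappa> = density (P \<Otimes>\<^sub>M Q) (\<lambda>z. ennreal (d (F (fst z)) (F (snd z))))"
  have PQ_sets[measurable_cong]: "sets (P \<Otimes>\<^sub>M Q) = sets (borel \<Otimes>\<^sub>M borel)"
    by (rule sets_pair_measure_cong[OF sets_P sets_Q])
  have \<kappa>_sets[measurable_cong]: "sets \<kappa> = sets (borel \<Otimes>\<^sub>M borel)" by (simp add: \<kappa>_def PQ_sets)
  have \<kappa>_space: "space \<kappa> = UNIV" using sets_eq_imp_space_eq[OF \<kappa>_sets] by (simp add: space_pair_measure)
  have intQ: "(\<integral>\<^sup>+y. ennreal (d (F x) (F y)) \<partial>Q) = 1" if "p (F x) \<noteq> 0" for x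
  proof -
    have "integrable Q (\<lambda>y. d (F x) (F y))" "(LINT y|Q. d (F x) (F y)) = (\<Sum>b\<in>?A. d (F x) b * q b)"
      using integral_finite_range[of Q ?A F "d (F x)"] fin Q.finite_measure_axioms lev
      unfolding space_Q sets_Q level q_def by auto
    moreover have "(\<Sum>b\<in>?A. d (F x) b * q b) = (\<Sum>b\<in>?A. m (F x) b / p (F x))"
      using mq[of "F x"] that by (intro sum.cong) (auto simp: d_def)
    moreover have "\<dots> = 1" using row[of "F x"] that by (simp add: sum_divide_distrib[symmetric])
    ultimately show ?thesis using d0 by (subst nn_integral_eq_integral) auto
  qed
  have intP: "(\<integral>\<^sup>+x. ennreal (d (F x) (F y)) \<partial>P) = 1" if "q (F y) \<noteq> 0" for y
  proof -
    have "integrable P (\<lambda>x. d (F x) (F y))" "(LINT x|P. d (F x) (F y)) = (\<Sum>a\<in>?A. d a (F y) * p a)"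
      using integral_finite_range[of P ?A F "\<lambda>a. d a (F y)"] fin P.finite_measure_axioms lev
      unfolding space_P sets_P level p_def by auto
    moreover have "(\<Sum>a\<in>?A. d a (F y) * p a) = (\<Sum>a\<in>?A. m a (F y) / q (F y))"
      using mp[of _ "F y"] that by (intro sum.cong) (auto simp: d_def)
    moreover have "\<dots> = 1" using col[of "F y"] that by (simp add: sum_divide_distrib[symmetric])
    ultimately show ?thesis using d0 by (subst nn_integral_eq_integral) auto
  qed
  \<comment> \<open>On level sets of mass 0 the density integrates to 0 rather than 1. There are
    finitely many of them, so the exception is a null set.\<close>
  have aeP: "AE x in P. p (F x) \<noteq> 0"
  proof -
    have "AE x in P. \<forall>a\<in>{a\<in>?A. p a = 0}. F x \<noteq> a"
    proof (rule AE_finite_allI)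
      fix a assume "a \<in> {a\<in>?A. p a = 0}"
      then have "F -` {a} \<in> null_sets P"
        by (auto simp: null_sets_def P.emeasure_eq_measure p_def sets_P)
      then show "AE x in P. F x \<noteq> a" by (rule AE_I') auto
    qed (use fin in auto)
    then show ?thesis by eventually_elim auto
  qed
  have aeQ: "AE x in Q. q (F x) \<noteq> 0"
  proof -
    have "AE x in Q. \<forall>a\<in>{a\<in>?A. q a = 0}. F x \<noteq> a"
    proof (rule AE_finite_allI)
      fix a assume "a \<in> {a\<in>?A. q a = 0}"
      then have "F -` {a} \<in> null_sets Q"
        by (auto simp: null_sets_def Q.emeasure_eq_measure q_def sets_Q)
      then show "AE x in Q. F x \<noteq> a" by (rule AE_I') auto
    qed (use fin in auto)
    then show ?thesis by eventually_elim auto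
  qed
  have fst: "distr \<kappa> borel fst = P"
  proof (rule measure_eqI)
    fix X assume "X \<in> sets (distr \<kappa> borel fst)"
    then have X[measurable]: "X \<in> sets borel" by simp
    have "emeasure (distr \<kappa> borel fst) X = emeasure \<kappa> (fst -` X)"
      by (subst emeasure_distr) (auto simp: \<kappa>_space)
    also have "\<dots> = (\<integral>\<^sup>+z. ennreal (d (F (fst z)) (F (snd z))) * indicator X (fst z) \<partial>(P \<Otimes>\<^sub>M Q))"
      unfolding \<kappa>_def using measurable_sets[OF measurable_fst X, of "borel :: 'a measure"]
      by (subst emeasure_density) (auto simp: PQ_sets space_pair_measure indicator_def intro!: nn_integral_cong)
    also have "\<dots> = (\<integral>\<^sup>+x. \<integral>\<^sup>+y. ennreal (d (F x) (F y)) * indicator X x \<partial>Q \<partial>P)"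
      by (subst Q.nn_integral_fst[symmetric]) auto
    also have "\<dots> = (\<integral>\<^sup>+x. indicator X x \<partial>P)"
    proof (rule nn_integral_cong_AE, use aeP in eventually_elim)
      fix x assume "p (F x) \<noteq> 0"
      from intQ[OF this] show "(\<integral>\<^sup>+y. ennreal (d (F x) (F y)) * indicator X x \<partial>Q) = indicator X x"
        by (auto split: split_indicator)
    qed
    also have "\<dots> = emeasure P X" by (simp add: sets_P)
    finally show "emeasure (distr \<kappa> borel fst) X = emeasure P X" .
  qed (simp add: sets_P)
  have snd: "distr \<kappa> borel snd = Q"
  proof (rule measure_eqI)
    fix X assume "X \<in> sets (distr \<kappa> borel snd)"
    then have X[measurable]: "X \<in> sets borel" by simp
    have "emeasure (distr \<kappa> borel snd) X = emeasure \<kappa> (snd -` X)"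
      by (subst emeasure_distr) (auto simp: \<kappa>_space)
    also have "\<dots> = (\<integral>\<^sup>+z. ennreal (d (F (fst z)) (F (snd z))) * indicator X (snd z) \<partial>(P \<Otimes>\<^sub>M Q))"
      unfolding \<kappa>_def using measurable_sets[OF measurable_snd X, of "borel :: 'a measure"]
      by (subst emeasure_density) (auto simp: PQ_sets space_pair_measure indicator_def intro!: nn_integral_cong)
    also have "\<dots> = (\<integral>\<^sup>+y. \<integral>\<^sup>+x. ennreal (d (F x) (F y)) * indicator X y \<partial>P \<partial>Q)"
      by (subst PQ.nn_integral_snd[symmetric]) auto
    also have "\<dots> = (\<integral>\<^sup>+y. indicator X y \<partial>Q)"
    proof (rule nn_integral_cong_AE, use aeQ in eventually_elim)
      fix y assume "q (F y) \<noteq> 0"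
      from intP[OF this] show "(\<integral>\<^sup>+x. ennreal (d (F x) (F y)) * indicator X y \<partial>P) = indicator X y"
        by (auto split: split_indicator)
    qed
    also have "\<dots> = emeasure Q X" by (simp add: sets_Q)
    finally show "emeasure (distr \<kappa> borel snd) X = emeasure Q X" .
  qed (simp add: sets_Q)
  have \<kappa>: "\<kappa> \<in> couplings P Q" using fst snd \<kappa>_sets by (simp add: couplings_def)
  interpret \<kappa>: prob_space \<kappa> using \<kappa> by (rule prob_space_coupling)
  have rect[measurable]: "F -` {a} \<times> F -` {b} \<in> sets (borel \<Otimes>\<^sub>M borel)" for a b by measurable
  have mass: "measure \<kappa> (F -` {a} \<times> F -` {b}) = m a b" if ab: "a \<in> ?A" "b \<in> ?A" for a b
  proof -
    have "emeasure \<kappa> (F -` {a} \<times> F -` {b}) =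
      (\<integral>\<^sup>+z. ennreal (d a b) * indicator (F -` {a} \<times> F -` {b}) z \<partial>(P \<Otimes>\<^sub>M Q))"
      unfolding \<kappa>_def using rect
      by (subst emeasure_density) (auto simp: PQ_sets indicator_def intro!: nn_integral_cong)
    also have "\<dots> = ennreal (d a b) * (ennreal (p a) * ennreal (q b))"
      using rect by (subst nn_integral_cmult_indicator)
        (auto simp: PQ_sets Q.emeasure_pair_measure_Times sets_P sets_Q P.emeasure_eq_measure Q.emeasure_eq_measure p_def q_def)
    also have "\<dots> = ennreal (m a b)"
      using d0 p0 dpq[OF ab] by (simp add: ennreal_mult[symmetric])
    finally show ?thesis using m0 by (simp add: measure_def)
  qed
  have "(LINT z|\<kappa>. h (F (fst z)) (F (snd z))) = matrix_cost ?A h m" for h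
  proof -
    have "(LINT z|\<kappa>. (case (F (fst z), F (snd z)) of (a, b) \<Rightarrow> h a b)) =
      (\<Sum>ab\<in>?A \<times> ?A. (case ab of (a, b) \<Rightarrow> h a b) * measure \<kappa> {z\<in>space \<kappa>. (F (fst z), F (snd z)) = ab})"
    proof (rule integral_finite_range)
      fix ab assume "ab \<in> ?A \<times> ?A"
      have "{z\<in>space \<kappa>. (F (fst z), F (snd z)) = ab} = F -` {fst ab} \<times> F -` {snd ab}"
        by (auto simp: \<kappa>_space)
      then show "{z\<in>space \<kappa>. (F (fst z), F (snd z)) = ab} \<in> sets \<kappa>" using rect by (simp add: \<kappa>_sets)
    qed (use fin \<kappa>.finite_measure_axioms in auto)
    also have "\<dots> = (\<Sum>ab\<in>?A \<times> ?A. case ab of (a, b) \<Rightarrow> m a b * h a b)"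
    proof (intro sum.cong refl)
      fix ab assume "ab \<in> ?A \<times> ?A"
      moreover have "{z\<in>space \<kappa>. (F (fst z), F (snd z)) = ab} = F -` {fst ab} \<times> F -` {snd ab}"
        by (auto simp: \<kappa>_space)
      ultimately show "(case ab of (a, b) \<Rightarrow> h a b) * measure \<kappa> {z\<in>space \<kappa>. (F (fst z), F (snd z)) = ab} =
        (case ab of (a, b) \<Rightarrow> m a b * h a b)"
        using mass[of "fst ab" "snd ab"] by (auto simp: mult.commute)
    qed
    finally show ?thesis by (simp add: matrix_cost_def sum.cartesian_product)
  qed
  with \<kappa> show ?thesis by blast
qed

end

section \<open>Compactness of the set of couplings\<close>

text \<open>All image laws sit on one common finite set, so convergence of the atom masses yields
  convergence on every measurable set, and no mass escapes. The limit is a finite weighted sum of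
  atoms, pushed forward to put it on the sigma-algebra of \<open>N\<close>.\<close>

lemma limit_law_finite_range:
  assumes prob: "\<And>n::nat. prob_space (M n)" and sets: "\<And>n. sets (M n) = sets K"
    and g: "g \<in> K \<rightarrow>\<^sub>M N" and fin: "finite (g ` space K)"
    and lev: "\<And>a. a \<in> g ` space K \<Longrightarrow> {z\<in>space K. g z = a} \<in> sets K"
    and conv: "\<And>a. a \<in> g ` space K \<Longrightarrow> convergent (\<lambda>n. measure (M n) {z\<in>space K. g z = a})"
  shows "\<exists>\<mu>. prob_space \<mu> \<and> sets \<mu> = sets N \<and>
    (\<forall>X\<in>sets N. (\<lambda>n. measure (M n) (g -` X \<inter> space K)) \<longlonglongrightarrow> measure \<mu> X)"
proof -
  let ?R = "g ` space K"
  define w where "w a = lim (\<lambda>n. measure (M n) {z\<in>space K. g z = a})" for a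
  have w: "(\<lambda>n. measure (M n) {z\<in>space K. g z = a}) \<longlonglongrightarrow> w a" if "a \<in> ?R" for a
    using conv[OF that] by (simp add: w_def convergent_LIMSEQ_iff)
  have w0: "0 \<le> w a" if "a \<in> ?R" for a
    using w[OF that] by (rule LIMSEQ_le_const) auto
  define \<mu> where "\<mu> = distr (point_measure ?R (\<lambda>a. ennreal (w a))) N (\<lambda>x. x)"
  have id: "(\<lambda>x. x) \<in> point_measure ?R (\<lambda>a. ennreal (w a)) \<rightarrow>\<^sub>M N"
    using measurable_space[OF g] by auto
  have \<mu>: "emeasure \<mu> X = ennreal (\<Sum>a\<in>X \<inter> ?R. w a)" if "X \<in> sets N" for X
  proof -
    have "emeasure \<mu> X = emeasure (point_measure ?R (\<lambda>a. ennreal (w a))) (X \<inter> ?R)"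
      unfolding \<mu>_def using id that by (subst emeasure_distr) (auto simp: space_point_measure)
    also have "\<dots> = (\<Sum>a\<in>X \<inter> ?R. ennreal (w a))"
      using fin by (intro emeasure_point_measure_finite) auto
    also have "\<dots> = ennreal (\<Sum>a\<in>X \<inter> ?R. w a)"
      using w0 by (intro sum_ennreal) auto
    finally show ?thesis .
  qed
  have lim: "(\<lambda>n. measure (M n) (g -` X \<inter> space K)) \<longlonglongrightarrow> (\<Sum>a\<in>X \<inter> ?R. w a)" for X
  proof -
    have "measure (M n) (g -` X \<inter> space K) = (\<Sum>a\<in>X \<inter> ?R. measure (M n) {z\<in>space K. g z = a})" for n
    proof -
      interpret prob_space "M n" by (rule prob)
      have "g -` X \<inter> space K = (\<Union>a\<in>X \<inter> ?R. {z\<in>space K. g z = a})" by auto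
      then show ?thesis
        using fin lev by (auto simp: sets disjoint_family_on_def intro!: finite_measure_finite_Union)
    qed
    then show ?thesis using w by (auto intro!: tendsto_sum)
  qed
  have \<mu>m: "measure \<mu> X = (\<Sum>a\<in>X \<inter> ?R. w a)" if "X \<in> sets N" for X
  proof -
    have "0 \<le> (\<Sum>a\<in>X \<inter> ?R. w a)" using w0 by (intro sum_nonneg) auto
    then show ?thesis using \<mu>[OF that] by (simp add: measure_def)
  qed
  have "prob_space \<mu>"
  proof
    have sp: "space \<mu> = space N" by (simp add: \<mu>_def)
    have "(\<lambda>n. 1) \<longlonglongrightarrow> (\<Sum>a\<in>space N \<inter> ?R. w a)"
    proof -
      have "measure (M n) (g -` space N \<inter> space K) = 1" for n
      proof -
        have "g -` space N \<inter> space K = space (M n)"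
          using measurable_space[OF g] sets_eq_imp_space_eq[OF sets[of n]] by auto
        then show ?thesis using prob_space.prob_space[OF prob] by simp
      qed
      then show ?thesis using lim[of "space N"] by simp
    qed
    then have "(\<Sum>a\<in>space N \<inter> ?R. w a) = 1" by (simp add: LIMSEQ_const_iff)
    then show "emeasure \<mu> (space \<mu>) = 1" using \<mu>[of "space N"] by (simp add: sp)
  qed
  moreover have "sets \<mu> = sets N" by (simp add: \<mu>_def)
  ultimately show ?thesis using lim \<mu>m by auto
qed

context marginals
begin

text \<open>Along a subsequence, all finite-dimensional laws of the sequence \<open>(F k x, F k y)\<^sub>k\<close> converge,
  because they live on finite sets. The limits are consistent, so Kolmogorov's theorem realizes them
  on the space of sequences, and \<open>(x, y)\<close> is recovered as the limit of the sequence. Its marginals are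
  right because those of the finite-dimensional laws do not depend on \<open>n\<close>.\<close>

lemma couplings_sequentially_compact:
  fixes F :: "nat \<Rightarrow> 'a \<Rightarrow> 'a"
  assumes \<kappa>: "\<And>n::nat. \<kappa> n \<in> couplings P Q"
    and F[measurable]: "\<And>k. F k \<in> borel_measurable borel" and fin: "\<And>k. finite (range (F k))"
    and F_lim: "\<And>x. (\<lambda>k. F k x) \<longlonglongrightarrow> x"
  shows "\<exists>r \<kappa>'. strict_mono (r :: nat \<Rightarrow> nat) \<and> \<kappa>' \<in> couplings P Q \<and>
    (\<forall>k (h :: 'a \<Rightarrow> 'a \<Rightarrow> real). (\<lambda>n. LINT z|\<kappa> (r n). h (F k (fst z)) (F k (snd z)))
      \<longlonglongrightarrow> (LINT z|\<kappa>'. h (F k (fst z)) (F k (snd z))))"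
proof -
  let ?B = "borel \<Otimes>\<^sub>M borel :: ('a \<times> 'a) measure"
  let ?E = "\<lambda>_::nat. borel :: ('a \<times> 'a) measure"
  have spB: "space ?B = UNIV" by (simp add: space_pair_measure)
  define G where "G k z = (F k (fst z), F k (snd z))" for k and z :: "'a \<times> 'a"
  have G[measurable]: "G k \<in> ?B \<rightarrow>\<^sub>M borel" for k
    unfolding G_def[abs_def] by measurable
  define GJ where "GJ J z = restrict (\<lambda>k. G k z) J" for J z
  have GJ[measurable]: "GJ J \<in> ?B \<rightarrow>\<^sub>M PiM J ?E" for J
    unfolding GJ_def[abs_def] by (rule measurable_restrict) (rule G)
  have GJ_fin: "finite (range (GJ J))" if "finite J" for J
  proof (rule finite_subset)
    show "range (GJ J) \<subseteq> PiE J (\<lambda>k. range (F k) \<times> range (F k))"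
      by (auto simp: GJ_def G_def)
    show "finite (PiE J (\<lambda>k. range (F k) \<times> range (F k)))"
      using that fin by (intro finite_PiE) auto
  qed
  have GJ_lev: "{z\<in>space ?B. GJ J z = a} \<in> sets ?B" if J: "finite J" and a: "a \<in> range (GJ J)" for J a
  proof -
    obtain z0 where "a = GJ J z0" using a by blast
    then have "{z\<in>space ?B. GJ J z = a} = {z\<in>space ?B. \<forall>k\<in>J. G k z = G k z0}"
      by (auto simp: GJ_def restrict_def fun_eq_iff)
    also have "\<dots> \<in> sets ?B"
      using J by (intro sets.sets_Collect_finite_All) measurable
    finally show ?thesis .
  qed
  \<comment> \<open>There are countably many finite \<open>J\<close>, and each \<open>GJ J\<close>
    has finite range, so one diagonal subsequence serves all finite-dimensional laws at
    once.\<close>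
  define S where "S = (\<Union>J\<in>Collect finite. (\<lambda>a. {z\<in>space ?B. GJ J z = a}) ` range (GJ J))"
  have "countable S"
    unfolding S_def using GJ_fin
    by (intro countable_UN countable_Collect_finite) (auto intro!: countable_finite)
  moreover have "0 \<le> measure (\<kappa> n) s \<and> measure (\<kappa> n) s \<le> 1" for n s
    using prob_space.prob_le_1[OF prob_space_coupling[OF \<kappa>]] by simp
  ultimately obtain r where r: "strict_mono (r :: nat \<Rightarrow> nat)"
    and conv: "\<And>s. s \<in> S \<Longrightarrow> convergent (\<lambda>n. measure (\<kappa> (r n)) s)"
    using diagonal_convergent_subsequence[of S "\<lambda>n. measure (\<kappa> n)"] by blast
  have "\<exists>\<mu>. finite J \<longrightarrow> prob_space \<mu> \<and> sets \<mu> = sets (PiM J ?E) \<and>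
    (\<forall>X\<in>sets (PiM J ?E). (\<lambda>n. measure (\<kappa> (r n)) (GJ J -` X \<inter> space ?B)) \<longlonglongrightarrow> measure \<mu> X)" for J
  proof (cases "finite J")
    case True
    have "\<exists>\<mu>. prob_space \<mu> \<and> sets \<mu> = sets (PiM J ?E) \<and>
      (\<forall>X\<in>sets (PiM J ?E). (\<lambda>n. measure (\<kappa> (r n)) (GJ J -` X \<inter> space ?B)) \<longlonglongrightarrow> measure \<mu> X)"
    proof (rule limit_law_finite_range)
      show "prob_space (\<kappa> (r n))" for n by (rule prob_space_coupling[OF \<kappa>])
      show "sets (\<kappa> (r n)) = sets ?B" for n by (rule sets_coupling[OF \<kappa>])
      show "finite (GJ J ` space ?B)" using GJ_fin[OF True] by (simp add: spB)
      fix a assume a: "a \<in> GJ J ` space ?B"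
      then show "{z\<in>space ?B. GJ J z = a} \<in> sets ?B" using GJ_lev[OF True] by (simp add: spB)
      have "{z\<in>space ?B. GJ J z = a} \<in> S" unfolding S_def using a True by (auto simp: spB)
      then show "convergent (\<lambda>n. measure (\<kappa> (r n)) {z\<in>space ?B. GJ J z = a})" by (rule conv)
    qed (rule GJ)
    then show ?thesis by blast
  qed simp
  then obtain PJ where PJ: "\<And>J. finite J \<Longrightarrow> prob_space (PJ J)" "\<And>J. finite J \<Longrightarrow> sets (PJ J) = sets (PiM J ?E)"
    and PJ_lim: "\<And>J X. finite J \<Longrightarrow> X \<in> sets (PiM J ?E) \<Longrightarrow>
      (\<lambda>n. measure (\<kappa> (r n)) (GJ J -` X \<inter> space ?B)) \<longlonglongrightarrow> measure (PJ J) X"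
    by metis
  interpret pp: polish_projective "UNIV :: nat set" PJ
  proof (intro polish_projective.intro projective_family.intro)
    fix J H :: "nat set" assume JH: "J \<subseteq> H" "finite H"
    then have finJ: "finite J" by (rule finite_subset)
    interpret H: prob_space "PJ H" using JH by (intro PJ)
    interpret J: prob_space "PJ J" using finJ by (intro PJ)
    have res: "(\<lambda>f. restrict f J) \<in> PJ H \<rightarrow>\<^sub>M PiM J ?E"
      using measurable_restrict_subset[OF JH(1), of ?E] PJ(2)[OF JH(2)] by (simp cong: measurable_cong_sets)
    \<comment> \<open>Consistency holds before the limit, since restricting \<open>GJ H z\<close> to
      \<open>J\<close> gives \<open>GJ J z\<close>; both masses are then limits of the same
      numerical sequence.\<close>
    show "PJ J = distr (PJ H) (PiM J ?E) (\<lambda>f. restrict f J)"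
    proof (rule measure_eqI)
      fix X assume "X \<in> sets (PJ J)"
      then have X: "X \<in> sets (PiM J ?E)" using PJ(2)[OF finJ] by simp
      let ?Y = "(\<lambda>f. restrict f J) -` X \<inter> space (PJ H)"
      have Y: "?Y \<in> sets (PiM H ?E)" using measurable_sets[OF res X] PJ(2)[OF JH(2)] by simp
      have "GJ H -` ?Y \<inter> space ?B = GJ J -` X \<inter> space ?B"
      proof -
        have "GJ H z \<in> space (PJ H)" for z
          using measurable_space[OF GJ, of z H] sets_eq_imp_space_eq[OF PJ(2)[OF JH(2)]] by (simp add: spB)
        moreover have "restrict (GJ H z) J = GJ J z" for z
          using JH(1) by (auto simp: GJ_def restrict_def fun_eq_iff)
        ultimately show ?thesis by auto
      qed
      then have "measure (PJ J) X = measure (PJ H) ?Y"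
        using PJ_lim[OF finJ X] PJ_lim[OF JH(2) Y] LIMSEQ_unique by metis
      then show "emeasure (PJ J) X = emeasure (distr (PJ H) (PiM J ?E) (\<lambda>f. restrict f J)) X"
        using res X by (simp add: emeasure_distr H.emeasure_eq_measure J.emeasure_eq_measure)
    qed (simp add: PJ finJ)
  qed (rule PJ(1))
  have L_sets[measurable_cong]: "sets pp.lim = sets (PiM UNIV ?E)" by simp
  \<comment> \<open>\<open>loc\<close> says that \<open>Y\<close> depends only on the coordinates in
    \<open>J\<close>, which makes the event a cylinder set, where the projective limit is given by
    \<open>PJ J\<close>.\<close>
  have L_lim: "(\<lambda>n. measure (\<kappa> (r n)) {z. Y (\<lambda>k. G k z)}) \<longlonglongrightarrow> measure pp.lim {\<omega>. Y \<omega>}"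
    if J: "finite J" and X: "{x\<in>space (PiM J ?E). Y x} \<in> sets (PiM J ?E)"
      and loc: "\<And>\<omega>. Y (restrict \<omega> J) \<longleftrightarrow> Y \<omega>" for J Y
  proof -
    have "prod_emb UNIV ?E J {x\<in>space (PiM J ?E). Y x} = {\<omega>. Y \<omega>}"
      by (auto simp: prod_emb_def space_PiM loc)
    then have "measure pp.lim {\<omega>. Y \<omega>} = measure (PJ J) {x\<in>space (PiM J ?E). Y x}"
      using pp.measure_lim_emb[of J "{x\<in>space (PiM J ?E). Y x}"] J X by simp
    moreover have "GJ J -` {x\<in>space (PiM J ?E). Y x} \<inter> space ?B = {z. Y (\<lambda>k. G k z)}"
      by (auto simp: GJ_def space_PiM spB loc)
    ultimately show ?thesis using PJ_lim[OF J X] by simp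
  qed
  let ?A = "\<lambda>_::nat. borel :: 'a measure"
  \<comment> \<open>\<open>\<pi>\<close> stands for \<open>fst\<close> or \<open>snd\<close>. A
    point \<open>x\<close> is encoded by the sequence of the \<open>F k x\<close> and decoded by
    \<open>lim\<close>. The sequence of the \<open>\<pi> (\<omega> k)\<close> has the law of the
    code of an \<open>R\<close>-distributed point, so decoding returns \<open>R\<close>, and almost
    every such sequence is the code of its own limit.\<close>
  have marginal: "distr pp.lim borel (\<lambda>\<omega>. lim (\<lambda>k. \<pi> (\<omega> k))) = R \<and>
      (\<forall>k. AE \<omega> in pp.lim. \<pi> (\<omega> k) = F k (lim (\<lambda>k. \<pi> (\<omega> k))))"
    if R: "\<And>n. distr (\<kappa> n) borel \<pi> = R" and \<pi>[measurable]: "\<pi> \<in> borel \<rightarrow>\<^sub>M borel"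
      and \<pi>G: "\<And>k z. \<pi> (G k z) = F k (\<pi> z)" for R and \<pi> :: "'a \<times> 'a \<Rightarrow> 'a"
  proof -
    have \<pi>B[measurable]: "\<pi> \<in> ?B \<rightarrow>\<^sub>M borel" using \<pi> by (simp add: borel_prod)
    have \<pi>\<kappa>[measurable]: "\<pi> \<in> \<kappa> n \<rightarrow>\<^sub>M borel" for n
      using \<pi>B sets_coupling[OF \<kappa>, of n] by (simp cong: measurable_cong_sets)
    have [measurable_cong]: "sets R = sets borel" using R[of 0] by auto
    have spR: "space R = UNIV" using sets_eq_imp_space_eq[OF \<open>sets R = sets borel\<close>] by simp
    interpret R: prob_space R
      using prob_space.prob_space_distr[OF prob_space_coupling[OF \<kappa>] \<pi>\<kappa>] R by metis
    have codeL[measurable]: "(\<lambda>\<omega> k. \<pi> (\<omega> k)) \<in> pp.lim \<rightarrow>\<^sub>M PiM UNIV ?A"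
      by (rule measurable_PiM_single') (auto simp: space_PiM)
    have codeR[measurable]: "(\<lambda>x k. F k x) \<in> R \<rightarrow>\<^sub>M PiM UNIV ?A"
      by (rule measurable_PiM_single') (auto simp: space_PiM)
    have law: "distr pp.lim (PiM UNIV ?A) (\<lambda>\<omega> k. \<pi> (\<omega> k)) = distr R (PiM UNIV ?A) (\<lambda>x k. F k x)"
    proof (rule measure_eqI_PiM_infinite)
      fix A and J :: "nat set" assume J: "finite J" and A: "\<And>i. i \<in> J \<Longrightarrow> A i \<in> sets (borel :: 'a measure)"
      have emb: "prod_emb UNIV ?A J (PiE J A) = {x. \<forall>k\<in>J. x k \<in> A k}"
        by (auto simp: prod_emb_def space_PiM)
      have emb_sets: "prod_emb UNIV ?A J (PiE J A) \<in> sets (PiM UNIV ?A)"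
        using J A by (intro measurable_prod_emb sets_PiM_I_finite) auto
      have lim1: "(\<lambda>n. measure (\<kappa> (r n)) {z. \<forall>k\<in>J. \<pi> (G k z) \<in> A k}) \<longlonglongrightarrow>
          measure pp.lim {\<omega>. \<forall>k\<in>J. \<pi> (\<omega> k) \<in> A k}"
      proof (rule L_lim[OF J])
        have "Measurable.pred (PiM J ?E) (\<lambda>x. \<pi> (x k) \<in> A k)" if "k \<in> J" for k
          using A[OF that] that by measurable
        then show "{x\<in>space (PiM J ?E). \<forall>k\<in>J. \<pi> (x k) \<in> A k} \<in> sets (PiM J ?E)"
          using J by (intro sets.sets_Collect_finite_All) (auto simp: pred_def)
      qed auto
      have Rset: "{x. \<forall>k\<in>J. F k x \<in> A k} \<in> sets borel"
      proof -
        have "{x \<in> space borel. F k x \<in> A k} \<in> sets borel" if "k \<in> J" for k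
          using A[OF that] by measurable
        from sets.sets_Collect_finite_All[OF this J] show ?thesis by simp
      qed
      \<comment> \<open>Constant in \<open>n\<close>: the event concerns \<open>\<pi> z\<close>
        alone, whose law under every \<open>\<kappa> n\<close> is \<open>R\<close>.\<close>
      have "measure (\<kappa> (r n)) {z. \<forall>k\<in>J. \<pi> (G k z) \<in> A k} = measure R {x. \<forall>k\<in>J. F k x \<in> A k}" for n
        using Rset by (subst R[of "r n", symmetric], subst measure_distr)
          (auto simp: \<pi>G space_coupling[OF \<kappa>] vimage_def)
      with lim1 have "measure pp.lim {\<omega>. \<forall>k\<in>J. \<pi> (\<omega> k) \<in> A k} = measure R {x. \<forall>k\<in>J. F k x \<in> A k}"
        by (simp add: LIMSEQ_const_iff)
      then show "emeasure (distr pp.lim (PiM UNIV ?A) (\<lambda>\<omega> k. \<pi> (\<omega> k))) (prod_emb UNIV ?A J (PiE J A)) =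
          emeasure (distr R (PiM UNIV ?A) (\<lambda>x k. F k x)) (prod_emb UNIV ?A J (PiE J A))"
        using emb_sets
        by (simp add: emeasure_distr emb space_PiM spR vimage_def pp.P.emeasure_eq_measure R.emeasure_eq_measure)
    next
      show "finite_measure (distr pp.lim (PiM UNIV ?A) (\<lambda>\<omega> k. \<pi> (\<omega> k)))"
        using pp.P.prob_space_distr[OF codeL] by (rule prob_space.finite_measure)
    qed simp_all
    have dec[measurable]: "(\<lambda>x. lim x) \<in> PiM UNIV ?A \<rightarrow>\<^sub>M borel"
      by (rule borel_measurable_lim_metric) measurable
    have decF: "lim (\<lambda>k. F k x) = x" for x using F_lim by (rule limI)
    have "distr pp.lim borel (\<lambda>\<omega>. lim (\<lambda>k. \<pi> (\<omega> k))) = distr (distr pp.lim (PiM UNIV ?A) (\<lambda>\<omega> k. \<pi> (\<omega> k))) borel (\<lambda>x. lim x)"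
      by (subst distr_distr) (auto simp: comp_def)
    also have "\<dots> = distr R borel (\<lambda>x. x)"
      unfolding law by (subst distr_distr) (auto simp: comp_def decF)
    also have "\<dots> = R"
      by (rule distr_id2) (simp add: \<open>sets R = sets borel\<close>)
    finally have 1: "distr pp.lim borel (\<lambda>\<omega>. lim (\<lambda>k. \<pi> (\<omega> k))) = R" .
    have "AE \<omega> in pp.lim. \<pi> (\<omega> k) = F k (lim (\<lambda>k. \<pi> (\<omega> k)))" for k
    proof -
      have ms: "{x\<in>space (PiM UNIV ?A). x k = F k (lim x)} \<in> sets (PiM UNIV ?A)" by measurable
      \<comment> \<open>For genuine codes this holds everywhere by \<open>decF\<close>; equality of
        the laws transports it to \<open>pp.lim\<close>.\<close>
      have "AE x in distr R (PiM UNIV ?A) (\<lambda>x k. F k x). x k = F k (lim x)"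
        by (subst AE_distr_iff[OF codeR ms]) (simp add: decF)
      then show ?thesis
        unfolding law[symmetric] by (subst (asm) AE_distr_iff[OF codeL ms])
    qed
    with 1 show ?thesis by blast
  qed
  have P': "distr pp.lim borel (\<lambda>\<omega>. lim (\<lambda>k. fst (\<omega> k))) = P"
      "\<And>k. AE \<omega> in pp.lim. fst (\<omega> k) = F k (lim (\<lambda>k. fst (\<omega> k)))"
    using marginal[of fst P] \<kappa> by (auto simp: couplings_def G_def borel_prod[symmetric])
  have Q': "distr pp.lim borel (\<lambda>\<omega>. lim (\<lambda>k. snd (\<omega> k))) = Q"
      "\<And>k. AE \<omega> in pp.lim. snd (\<omega> k) = F k (lim (\<lambda>k. snd (\<omega> k)))"
    using marginal[of snd Q] \<kappa> by (auto simp: couplings_def G_def borel_prod[symmetric])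
  have coord[measurable]: "(\<lambda>\<omega>. fst (\<omega> k)) \<in> borel_measurable pp.lim" "(\<lambda>\<omega>. snd (\<omega> k)) \<in> borel_measurable pp.lim" for k
  proof -
    have "(\<lambda>\<omega>. \<omega> k) \<in> pp.lim \<rightarrow>\<^sub>M ?B" unfolding borel_prod by measurable
    from measurable_compose[OF this measurable_fst] measurable_compose[OF this measurable_snd]
    show "(\<lambda>\<omega>. fst (\<omega> k)) \<in> borel_measurable pp.lim" "(\<lambda>\<omega>. snd (\<omega> k)) \<in> borel_measurable pp.lim" by auto
  qed
  \<comment> \<open>\<open>lim\<close> is unspecified on sequences without a limit, but almost
    surely both coordinate sequences are codes and converge.\<close>
  define D where "D \<omega> = (lim (\<lambda>k. fst (\<omega> k)), lim (\<lambda>k. snd (\<omega> k)))" for \<omega> :: "nat \<Rightarrow> 'a \<times> 'a"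
  have D[measurable]: "D \<in> pp.lim \<rightarrow>\<^sub>M ?B" unfolding D_def[abs_def] by measurable
  define \<kappa>' where "\<kappa>' = distr pp.lim ?B D"
  have \<kappa>': "\<kappa>' \<in> couplings P Q"
    unfolding couplings_def \<kappa>'_def
    by (auto simp: distr_distr comp_def D_def P' Q')
  have mass: "(\<lambda>n. measure (\<kappa> (r n)) {z. G k z = ab}) \<longlonglongrightarrow> measure \<kappa>' {z. G k z = ab}" for k ab
  proof -
    have Gs: "{z. G k z = ab} \<in> sets ?B"
    proof -
      have "{z\<in>space ?B. G k z = ab} \<in> sets ?B" by measurable
      then show ?thesis by (simp add: spB)
    qed
    have "(\<lambda>n. measure (\<kappa> (r n)) {z. G k z = ab}) \<longlonglongrightarrow> measure pp.lim {\<omega>. \<omega> k = ab}"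
    proof (rule L_lim[of "{k}" "\<lambda>\<omega>. \<omega> k = ab"])
      show "{x\<in>space (PiM {k} ?E). x k = ab} \<in> sets (PiM {k} ?E)" by measurable
    qed auto
    \<comment> \<open>\<open>\<omega> k\<close> and \<open>G k (D \<omega>)\<close> agree almost
      surely, so the limit mass, known for the \<open>k\<close>-th coordinate, is also that of the
      discretized decoded point.\<close>
    also have "measure pp.lim {\<omega>. \<omega> k = ab} = measure pp.lim {\<omega>. G k (D \<omega>) = ab}"
    proof (rule measure_eq_AE)
      show "AE \<omega> in pp.lim. (\<omega> \<in> {\<omega>. \<omega> k = ab}) = (\<omega> \<in> {\<omega>. G k (D \<omega>) = ab})"
        using P'(2)[of k] Q'(2)[of k]
      proof eventually_elim
        case (elim \<omega>)
        then have "G k (D \<omega>) = \<omega> k" by (simp add: G_def D_def prod_eq_iff)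
        then show ?case by simp
      qed
      have "{\<omega>\<in>space pp.lim. \<omega> k = ab} \<in> sets pp.lim" by measurable
      then show "{\<omega>. \<omega> k = ab} \<in> sets pp.lim" by (simp add: space_PiM)
      have "{\<omega>\<in>space pp.lim. G k (D \<omega>) = ab} \<in> sets pp.lim" by measurable
      then show "{\<omega>. G k (D \<omega>) = ab} \<in> sets pp.lim" by (simp add: space_PiM)
    qed
    also have "\<dots> = measure \<kappa>' {z. G k z = ab}"
      unfolding \<kappa>'_def using Gs by (subst measure_distr) (auto simp: space_PiM vimage_def)
    finally show ?thesis .
  qed
  have expand: "(LINT z|\<eta>. h (F k (fst z)) (F k (snd z))) =
      (\<Sum>ab\<in>range (F k) \<times> range (F k). h (fst ab) (snd ab) * measure \<eta> {z. G k z = ab})"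
    if \<eta>: "\<eta> \<in> couplings P Q" for \<eta> k and h :: "'a \<Rightarrow> 'a \<Rightarrow> real"
  proof -
    have "(LINT z|\<eta>. h (fst (G k z)) (snd (G k z))) =
        (\<Sum>ab\<in>range (F k) \<times> range (F k). h (fst ab) (snd ab) * measure \<eta> {z\<in>space \<eta>. G k z = ab})"
    proof (rule integral_finite_range(2)[where g="\<lambda>ab. h (fst ab) (snd ab)"])
      show "finite_measure \<eta>" using prob_space_coupling[OF \<eta>] by (rule prob_space.finite_measure)
      have [measurable_cong]: "sets \<eta> = sets ?B" using \<eta> by (rule sets_coupling)
      show "{z\<in>space \<eta>. G k z = ab} \<in> sets \<eta>" for ab by measurable
    qed (use fin in \<open>auto simp: G_def\<close>)
    then show ?thesis by (simp add: G_def space_coupling[OF \<eta>])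
  qed
  have "(\<lambda>n. LINT z|\<kappa> (r n). h (F k (fst z)) (F k (snd z))) \<longlonglongrightarrow> (LINT z|\<kappa>'. h (F k (fst z)) (F k (snd z)))"
    for k and h :: "'a \<Rightarrow> 'a \<Rightarrow> real"
    unfolding expand[OF \<kappa>] expand[OF \<kappa>'] by (intro tendsto_sum tendsto_mult tendsto_const mass)
  with r \<kappa>' show ?thesis by blast
qed

end

section \<open>Duality and optimal couplings\<close>

text \<open>The joint Lipschitz bound controls discretization by the first moments; with
  \<open>c_refl\<close> it also gives linear growth, hence integrability of the cost under every
  coupling.\<close>

locale transport_problem = marginals P Q for P Q :: "'a::euclidean_space measure" +
  fixes c :: "'a \<Rightarrow> 'a \<Rightarrow> real" and L :: real
  assumes c_nonneg: "\<And>x y. 0 \<le> c x y" and c_refl: "\<And>x. c x x = 0"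
    and c_tri: "\<And>x y z. c x z \<le> c x y + c y z"
    and c_lipschitz: "\<And>x y x' y'. \<bar>c x y - c x' y'\<bar> \<le> L * (norm (x - x') + norm (y - y'))"
    and c_measurable[measurable]: "(\<lambda>z. c (fst z) (snd z)) \<in> borel_measurable (borel \<Otimes>\<^sub>M borel)"
begin

lemma c_le_norm: "c x y \<le> L * norm (x - y)"
  using c_lipschitz[of x y x x] by (simp add: c_refl norm_minus_commute)

lemma integrable_cost:
  assumes \<kappa>: "\<kappa> \<in> couplings P Q"
  shows "integrable \<kappa> (\<lambda>z. c (fst z) (snd z))"
proof (rule Bochner_Integration.integrable_bound)
  have [measurable_cong]: "sets \<kappa> = sets (borel \<Otimes>\<^sub>M borel)" using \<kappa> by (rule sets_coupling)
  show "integrable \<kappa> (\<lambda>z. L * (norm (fst z) + norm (snd z)))"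
    using integrable_coupling_fst[OF \<kappa>, of norm] integrable_coupling_snd[OF \<kappa>, of norm] moment_P moment_Q
    by (intro integrable_mult_right Bochner_Integration.integrable_add) auto
  show "(\<lambda>z. c (fst z) (snd z)) \<in> borel_measurable \<kappa>" by measurable
  show "AE z in \<kappa>. norm (c (fst z) (snd z)) \<le> norm (L * (norm (fst z) + norm (snd z)))"
  proof (intro AE_I2)
    fix z :: "'a \<times> 'a"
    show "norm (c (fst z) (snd z)) \<le> norm (L * (norm (fst z) + norm (snd z)))"
      using c_lipschitz[of "fst z" "snd z" 0 0] by (simp add: c_refl)
  qed
qed

text \<open>Exchanging \<open>x\<close> and \<open>y\<close> makes the one-sided bound two-sided,
  and \<open>c_le_norm\<close> turns it into the Lipschitz property for the norm. Linear growth then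
  gives integrability.\<close>

lemma
  fixes f :: "'a \<Rightarrow> real"
  assumes f: "\<And>x y. f y - f x \<le> c x y"
  shows one_lipschitz_continuous: "continuous_on UNIV f"
    and one_lipschitz_measurable: "f \<in> borel_measurable borel"
    and one_lipschitz_integrable_P: "integrable P f"
    and one_lipschitz_integrable_Q: "integrable Q f"
proof -
  have lip: "\<bar>f y - f x\<bar> \<le> L * norm (y - x)" for x y
    using f[of y x] f[of x y] c_le_norm[of x y] c_le_norm[of y x] by (simp add: norm_minus_commute)
  have "0 \<le> L"
  proof (rule ccontr)
    assume "\<not> 0 \<le> L"
    obtain b :: 'a where "b \<in> Basis" using nonempty_Basis by blast
    with lip[of b 0] \<open>\<not> 0 \<le> L\<close> show False by simp
  qed
  have "L-lipschitz_on UNIV f"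
    using lip \<open>0 \<le> L\<close> by (auto intro!: lipschitz_onI simp: dist_norm)
  then show cont: "continuous_on UNIV f" by (rule lipschitz_on_continuous_on)
  from cont show meas[measurable]: "f \<in> borel_measurable borel"
    by (rule borel_measurable_continuous_onI)
  have bound: "norm (f x) \<le> norm (\<bar>f 0\<bar> + L * norm x)" for x
    using lip[of x 0] \<open>0 \<le> L\<close> by simp
  show "integrable P f"
    by (rule Bochner_Integration.integrable_bound[of P "\<lambda>x. \<bar>f 0\<bar> + L * norm x"])
      (use moment_P bound in auto)
  show "integrable Q f"
    by (rule Bochner_Integration.integrable_bound[of Q "\<lambda>x. \<bar>f 0\<bar> + L * norm x"])
      (use moment_Q bound in auto)
qed

lemma weak_duality:
  fixes f :: "'a \<Rightarrow> real"
  assumes \<kappa>: "\<kappa> \<in> couplings P Q" and f: "\<And>x y. f y - f x \<le> c x y"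
  shows "(LINT y|Q. f y) - (LINT x|P. f x) \<le> (LINT z|\<kappa>. c (fst z) (snd z))"
proof -
  note [measurable] = one_lipschitz_measurable[OF f]
  have int: "integrable \<kappa> (\<lambda>z. f (fst z))" "integrable \<kappa> (\<lambda>z. f (snd z))"
    using integrable_coupling_fst[OF \<kappa>, of f] integrable_coupling_snd[OF \<kappa>, of f]
      one_lipschitz_integrable_P[OF f] one_lipschitz_integrable_Q[OF f] by auto
  have "(LINT y|Q. f y) - (LINT x|P. f x) = (LINT z|\<kappa>. f (snd z) - f (fst z))"
    using int integral_coupling_fst[OF \<kappa>, of f] integral_coupling_snd[OF \<kappa>, of f] by simp
  also have "\<dots> \<le> (LINT z|\<kappa>. c (fst z) (snd z))"
    using int integrable_cost[OF \<kappa>] f by (intro integral_mono) auto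
  finally show ?thesis .
qed

text \<open>Each term of the Lipschitz bound involves one coordinate only, so its integral sees just
  a marginal. The right-hand side is thus the same for every coupling and can be used along a whole
  sequence of couplings.\<close>

lemma cost_discretization_error:
  assumes \<kappa>: "\<kappa> \<in> couplings P Q" and [measurable]: "F \<in> borel_measurable borel"
    and fin: "finite (range F)"
    and bd: "\<And>x. norm (F x) \<le> 2 * norm x"
  shows "\<bar>(LINT z|\<kappa>. c (fst z) (snd z)) - (LINT z|\<kappa>. c (F (fst z)) (F (snd z)))\<bar>
    \<le> L * ((LINT x|P. norm (F x - x)) + (LINT y|Q. norm (F y - y)))"
proof -
  have [measurable_cong]: "sets \<kappa> = sets (borel \<Otimes>\<^sub>M borel)" using \<kappa> by (rule sets_coupling)
  have bound: "norm (norm (F x - x)) \<le> norm (3 * norm x)" for x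
    using norm_triangle_ineq4[of "F x" x] bd[of x] by simp
  have intPQ: "integrable P (\<lambda>x. norm (F x - x))" "integrable Q (\<lambda>x. norm (F x - x))"
    by (rule Bochner_Integration.integrable_bound[of _ "\<lambda>x. 3 * norm x"]; use moment_P moment_Q bound in auto)+
  have int: "integrable \<kappa> (\<lambda>z. norm (F (fst z) - fst z))" "integrable \<kappa> (\<lambda>z. norm (F (snd z) - snd z))"
    using intPQ integrable_coupling_fst[OF \<kappa>, of "\<lambda>x. norm (F x - x)"]
      integrable_coupling_snd[OF \<kappa>, of "\<lambda>x. norm (F x - x)"] by auto
  have intF: "integrable \<kappa> (\<lambda>z. c (F (fst z)) (F (snd z)))"
  proof -
    have "integrable \<kappa> (\<lambda>z. case (F (fst z), F (snd z)) of (a, b) \<Rightarrow> c a b)"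
    proof (rule integral_finite_range(1)[where g="\<lambda>(a, b). c a b" and B="range F \<times> range F"])
      show "finite_measure \<kappa>" using prob_space_coupling[OF \<kappa>] by (rule prob_space.finite_measure)
      show "{z\<in>space \<kappa>. (F (fst z), F (snd z)) = b} \<in> sets \<kappa>" for b by measurable
    qed (use fin in auto)
    then show ?thesis by simp
  qed
  have "\<bar>(LINT z|\<kappa>. c (fst z) (snd z)) - (LINT z|\<kappa>. c (F (fst z)) (F (snd z)))\<bar> =
      \<bar>LINT z|\<kappa>. c (fst z) (snd z) - c (F (fst z)) (F (snd z))\<bar>"
    using intF integrable_cost[OF \<kappa>] by simp
  also have "\<dots> \<le> (LINT z|\<kappa>. \<bar>c (fst z) (snd z) - c (F (fst z)) (F (snd z))\<bar>)"
    by (rule integral_abs_bound)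
  also have "\<dots> \<le> (LINT z|\<kappa>. L * (norm (F (fst z) - fst z) + norm (F (snd z) - snd z)))"
  proof (rule integral_mono)
    show "integrable \<kappa> (\<lambda>z. \<bar>c (fst z) (snd z) - c (F (fst z)) (F (snd z))\<bar>)"
      using intF integrable_cost[OF \<kappa>] by (intro integrable_abs Bochner_Integration.integrable_diff)
    show "integrable \<kappa> (\<lambda>z. L * (norm (F (fst z) - fst z) + norm (F (snd z) - snd z)))"
      using int by (intro integrable_mult_right Bochner_Integration.integrable_add)
    show "\<bar>c (fst z) (snd z) - c (F (fst z)) (F (snd z))\<bar> \<le> L * (norm (F (fst z) - fst z) + norm (F (snd z) - snd z))" for z
      using c_lipschitz[of "fst z" "snd z" "F (fst z)" "F (snd z)"] by (simp add: norm_minus_commute)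
  qed
  also have "\<dots> = L * ((LINT x|P. norm (F x - x)) + (LINT y|Q. norm (F y - y)))"
    using int integral_coupling_fst[OF \<kappa>, of "\<lambda>x. norm (F x - x)"]
      integral_coupling_snd[OF \<kappa>, of "\<lambda>x. norm (F x - x)"] by simp
  finally show ?thesis .
qed

text \<open>McShane's extension of the values \<open>C\<close> on \<open>A\<close>. The potential of
  the finite duality is an infimum over infinitely many chains; this form involves finitely many
  cones and admits an explicit smoothing.\<close>

definition min_cone :: "'a set \<Rightarrow> ('a \<Rightarrow> real) \<Rightarrow> 'a \<Rightarrow> real"
  where "min_cone A C y = Min ((\<lambda>a. C a + c a y) ` A)"

lemma min_cone_one_lipschitz:
  assumes "finite A" "A \<noteq> {}"
  shows "min_cone A C y - min_cone A C x \<le> c x y"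
proof -
  have "min_cone A C x \<in> (\<lambda>a. C a + c a x) ` A"
    unfolding min_cone_def using assms by (intro Min_in) auto
  then obtain a where a: "a \<in> A" "min_cone A C x = C a + c a x" by auto
  have "min_cone A C y \<le> C a + c a y"
    unfolding min_cone_def using a assms by (intro Min_le) auto
  then show ?thesis using a c_tri[of a y x] by simp
qed

lemma min_cone_eq:
  assumes "finite A" and f: "\<And>x y. f y - f x \<le> c x y" and "x \<in> A"
  shows "min_cone A f x = f x"
proof -
  have "f x \<le> f a + c a x" for a using f[of x a] by simp
  then show ?thesis
    unfolding min_cone_def using assms by (intro Min_eqI) (auto simp: c_refl intro!: rev_image_eqI)
qed

lemma approximate_duality:
  assumes \<epsilon>: "0 < \<epsilon>"
  shows "\<exists>\<kappa>\<in>couplings P Q. \<exists>A C. finite A \<and> A \<noteq> {} \<and>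
    (LINT z|\<kappa>. c (fst z) (snd z)) \<le> (LINT y|Q. min_cone A C y) - (LINT x|P. min_cone A C x) + \<epsilon>"
proof -
  obtain F :: "nat \<Rightarrow> 'a \<Rightarrow> 'a" where F: "\<And>k. F k \<in> borel_measurable borel" "\<And>k. finite (range (F k))"
    "\<And>x. (\<lambda>k. F k x) \<longlonglongrightarrow> x" "\<And>k x. norm (F k x) \<le> 2 * norm x"
    by (rule simple_approximation_of_identity) blast
  define e where "e k = L * ((LINT x|P. norm (F k x - x)) + (LINT y|Q. norm (F k y - y)))" for k
  have "e \<longlonglongrightarrow> L * (0 + 0)"
    unfolding e_def
    by (intro tendsto_mult tendsto_add tendsto_const approximation_of_identity_L1 sets_P sets_Q moment_P moment_Q F)
  \<comment> \<open>Half of \<open>\<epsilon>\<close>, because \<open>e k\<close> is spent twice: on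
    the cost of the coupling, and on replacing the potential at \<open>F k x\<close> by its value at
    \<open>x\<close>.\<close>
  then have "eventually (\<lambda>k. e k < \<epsilon> / 2) sequentially"
    using \<epsilon> by (intro order_tendstoD(2)[of _ 0]) auto
  then obtain k where k: "e k < \<epsilon> / 2" by (auto simp: eventually_sequentially)
  let ?F = "F k" let ?A = "range (F k)"
  note [measurable] = F(1)
  define p where "p a = measure P (?F -` {a})" for a
  define q where "q a = measure Q (?F -` {a})" for a
  have lev: "?F -` {a} \<in> sets borel" for a
    using measurable_sets[OF F(1), of "{a}" k] by simp
  have level: "{z \<in> UNIV. ?F z = a} = ?F -` {a}" for a by auto
  have intP: "integrable P (\<lambda>x. g (?F x))" "(LINT x|P. g (?F x)) = (\<Sum>a\<in>?A. g a * p a)" for g :: "'a \<Rightarrow> real"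
    using integral_finite_range[of P ?A ?F g] F(2) P.finite_measure_axioms lev
    unfolding space_P sets_P level p_def by auto
  have intQ: "integrable Q (\<lambda>x. g (?F x))" "(LINT x|Q. g (?F x)) = (\<Sum>a\<in>?A. g a * q a)" for g :: "'a \<Rightarrow> real"
    using integral_finite_range[of Q ?A ?F g] F(2) Q.finite_measure_axioms lev
    unfolding space_Q sets_Q level q_def by auto
  have "sum p ?A = 1" "sum q ?A = 1"
    using intP(2)[of "\<lambda>_. 1"] intQ(2)[of "\<lambda>_. 1"] P.prob_space Q.prob_space by auto
  moreover have "0 \<le> p a" "0 \<le> q a" for a by (auto simp: p_def q_def)
  ultimately obtain m f where m: "m \<in> transport_matrices ?A p q" and f: "\<And>x y. f y - f x \<le> c x y"
    and cost: "matrix_cost ?A c m = (\<Sum>a\<in>?A. f a * q a) - (\<Sum>a\<in>?A. f a * p a)"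
    using finite_kantorovich_duality[of ?A p q c] F(2) c_nonneg c_refl c_tri by blast
  obtain \<kappa> where \<kappa>: "\<kappa> \<in> couplings P Q"
    and \<kappa>_cost: "(LINT z|\<kappa>. c (?F (fst z)) (?F (snd z))) = matrix_cost ?A c m"
    using coupling_from_matrix[of ?F m] F(1,2) m unfolding p_def q_def by blast
  \<comment> \<open>The dual value involves \<open>f\<close> on the finite range alone, so the cone
    function with the same values there replaces it without loss.\<close>
  let ?f = "min_cone ?A f"
  have A: "finite ?A" "?A \<noteq> {}" using F(2) by auto
  have f': "?f y - ?f x \<le> c x y" for x y using A by (rule min_cone_one_lipschitz)
  have f_eq: "f (?F x) = ?f (?F x)" for x using min_cone_eq[OF A(1) f] by simp
  have close: "\<bar>?f (?F x) - ?f x\<bar> \<le> L * norm (?F x - x)" for x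
    using f'[of "?F x" x] f'[of x "?F x"] c_le_norm[of x "?F x"] c_le_norm[of "?F x" x]
    by (simp add: norm_minus_commute)
  have bound: "norm (L * norm (?F x - x)) \<le> norm (L * (3 * norm x))" for x
    using norm_triangle_ineq4[of "?F x" x] F(4)[of k x] by (simp add: abs_mult mult_left_mono)
  have "integrable P (\<lambda>x. L * norm (?F x - x))"
    by (rule Bochner_Integration.integrable_bound[of P "\<lambda>x. L * (3 * norm x)"]) (use moment_P bound in auto)
  then have "(LINT x|P. ?f x - ?f (?F x)) \<le> (LINT x|P. L * norm (?F x - x))"
    using close one_lipschitz_integrable_P[OF f'] intP(1)[of ?f]
    by (intro integral_mono Bochner_Integration.integrable_diff) (auto simp: abs_le_iff)
  then have eP: "(LINT x|P. ?f x) - (LINT x|P. ?f (?F x)) \<le> L * (LINT x|P. norm (?F x - x))"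
    using one_lipschitz_integrable_P[OF f'] intP(1)[of ?f] by simp
  have "integrable Q (\<lambda>x. L * norm (?F x - x))"
    by (rule Bochner_Integration.integrable_bound[of Q "\<lambda>x. L * (3 * norm x)"]) (use moment_Q bound in auto)
  then have "(LINT x|Q. ?f (?F x) - ?f x) \<le> (LINT x|Q. L * norm (?F x - x))"
    using close one_lipschitz_integrable_Q[OF f'] intQ(1)[of ?f]
    by (intro integral_mono Bochner_Integration.integrable_diff) (auto simp: abs_le_iff)
  then have eQ: "(LINT x|Q. ?f (?F x)) - (LINT x|Q. ?f x) \<le> L * (LINT x|Q. norm (?F x - x))"
    using one_lipschitz_integrable_Q[OF f'] intQ(1)[of ?f] by simp
  have "(LINT z|\<kappa>. c (fst z) (snd z)) \<le> matrix_cost ?A c m + e k"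
    using cost_discretization_error[OF \<kappa> F(1,2,4), of k] \<kappa>_cost by (simp add: e_def)
  also have "matrix_cost ?A c m = (LINT x|Q. ?f (?F x)) - (LINT x|P. ?f (?F x))"
    unfolding cost intP(2)[symmetric] intQ(2)[symmetric] by (simp add: f_eq)
  also have "\<dots> \<le> (LINT x|Q. ?f x) - (LINT x|P. ?f x) + e k"
    using eP eQ by (simp add: e_def algebra_simps)
  finally have "(LINT z|\<kappa>. c (fst z) (snd z)) \<le> (LINT x|Q. ?f x) - (LINT x|P. ?f x) + \<epsilon>"
    using k by simp
  with \<kappa> A show ?thesis by blast
qed

text \<open>Along a minimizing sequence, the discretized costs at a fixed \<open>k\<close> converge.
  Passing to them from the original costs and back at the limit coupling loses \<open>e k\<close>
  each time, uniformly in \<open>n\<close>; so \<open>n\<close> goes to infinity first, and then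
  \<open>2 * e k\<close> tends to 0.\<close>

lemma optimal_coupling_exists:
  "\<exists>\<kappa>\<in>couplings P Q. \<forall>\<eta>\<in>couplings P Q. (LINT z|\<kappa>. c (fst z) (snd z)) \<le> (LINT z|\<eta>. c (fst z) (snd z))"
proof -
  let ?I = "\<lambda>\<kappa>. LINT z|\<kappa>. c (fst z) (snd z)"
  define W where "W = (INF \<kappa>\<in>couplings P Q. ?I \<kappa>)"
  have ne: "couplings P Q \<noteq> {}" using approximate_duality[of 1] by auto
  have bdd: "bdd_below (?I ` couplings P Q)"
    by (intro bdd_belowI[of _ 0]) (auto intro!: Bochner_Integration.integral_nonneg c_nonneg)
  have "\<exists>\<kappa>. \<kappa> \<in> couplings P Q \<and> ?I \<kappa> < W + 1 / real (Suc n)" for n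
    using cINF_less_iff[OF ne bdd, of "W + 1 / real (Suc n)"] unfolding W_def[symmetric] by force
  then obtain \<kappa> where \<kappa>: "\<And>n. \<kappa> n \<in> couplings P Q" and \<kappa>W: "\<And>n. ?I (\<kappa> n) < W + 1 / real (Suc n)"
    by metis
  obtain F :: "nat \<Rightarrow> 'a \<Rightarrow> 'a" where F: "\<And>k. F k \<in> borel_measurable borel" "\<And>k. finite (range (F k))"
    "\<And>x. (\<lambda>k. F k x) \<longlonglongrightarrow> x" "\<And>k x. norm (F k x) \<le> 2 * norm x"
    by (rule simple_approximation_of_identity) blast
  obtain r \<kappa>' where r: "strict_mono (r :: nat \<Rightarrow> nat)" and \<kappa>': "\<kappa>' \<in> couplings P Q"
    and conv: "\<And>k. (\<lambda>n. LINT z|\<kappa> (r n). c (F k (fst z)) (F k (snd z))) \<longlonglongrightarrow> (LINT z|\<kappa>'. c (F k (fst z)) (F k (snd z)))"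
    using couplings_sequentially_compact[where \<kappa> = \<kappa> and F = F, OF \<kappa> F(1-3)] by blast
  define e where "e k = L * ((LINT x|P. norm (F k x - x)) + (LINT y|Q. norm (F k y - y)))" for k
  have e: "e \<longlonglongrightarrow> L * (0 + 0)"
    unfolding e_def
    by (intro tendsto_mult tendsto_add tendsto_const approximation_of_identity_L1 sets_P sets_Q moment_P moment_Q F)
  have "?I \<kappa>' \<le> W + 2 * e k" for k
  proof -
    have "(LINT z|\<kappa>'. c (F k (fst z)) (F k (snd z))) \<le> W + e k"
    proof (rule LIMSEQ_le[OF conv])
      have "(\<lambda>n. W + e k + 1 / real (Suc n)) \<longlonglongrightarrow> W + e k + 0"
        by (intro tendsto_add tendsto_const LIMSEQ_Suc[OF lim_1_over_n])
      then show "(\<lambda>n. W + e k + 1 / real (Suc (r n))) \<longlonglongrightarrow> W + e k"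
        using LIMSEQ_subseq_LIMSEQ[OF _ r, of "\<lambda>n. W + e k + 1 / real (Suc n)" "W + e k"] by (simp add: comp_def)
      have "(LINT z|\<kappa> (r n). c (F k (fst z)) (F k (snd z))) \<le> W + e k + 1 / real (Suc (r n))" for n
        using cost_discretization_error[OF \<kappa> F(1,2,4), of "r n" k] \<kappa>W[of "r n"] unfolding e_def by linarith
      then show "\<exists>N. \<forall>n\<ge>N. (LINT z|\<kappa> (r n). c (F k (fst z)) (F k (snd z))) \<le> W + e k + 1 / real (Suc (r n))"
        by blast
    qed
    then show ?thesis
      using cost_discretization_error[OF \<kappa>' F(1,2,4), of k] unfolding e_def by linarith
  qed
  moreover have "(\<lambda>k. W + 2 * e k) \<longlonglongrightarrow> W + 2 * (L * (0 + 0))"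
    using e by (intro tendsto_intros)
  ultimately have "?I \<kappa>' \<le> W"
    using LIMSEQ_le_const[of "\<lambda>k. W + 2 * e k" W "?I \<kappa>'"] by auto
  then show ?thesis
    using \<kappa>' cINF_lower[OF bdd] unfolding W_def by force
qed

end

section \<open>Test functions\<close>

lemma partial_deriv_eq:
  fixes u :: "real^'n \<Rightarrow> real"
  assumes "(u has_derivative u') (at x)"
  shows "partial_deriv i u x = u' (axis i 1)"
proof -
  have "((\<lambda>t::real. x + t *\<^sub>R axis i 1) has_derivative (\<lambda>t. t *\<^sub>R axis i 1)) (at 0)"
    by (auto intro!: derivative_eq_intros)
  moreover have "(u has_derivative u') (at (x + 0 *\<^sub>R axis i 1))"
    using assms by simp
  ultimately have "((\<lambda>t. u (x + t *\<^sub>R axis i 1)) has_derivative (\<lambda>t. u' (t *\<^sub>R axis i 1))) (at 0)"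
    by (rule has_derivative_compose)
  moreover have "u' (t *\<^sub>R axis i 1) = u' (axis i 1) * t" for t
    using linear_scale[OF has_derivative_linear[OF assms]] by simp
  ultimately have "((\<lambda>t. u (x + t *\<^sub>R axis i 1)) has_field_derivative u' (axis i 1)) (at 0)"
    by (simp add: has_field_derivative_def)
  then show ?thesis
    unfolding partial_deriv_def by (rule DERIV_imp_deriv)
qed

text \<open>By the mean value theorem on the segment, the increment is the sum of
  \<open>(y $ i - x $ i) * partial_deriv i u w\<close> at a single point \<open>w\<close>; rising
  coordinates are estimated with \<open>l\<close>, falling ones with \<open>h\<close>. The bounds
  are \<open>\<gamma> * \<beta> i\<close> and \<open>\<beta> i\<close> for MASD test functions,
  \<open>- \<beta> i\<close> and \<open>\<beta> i\<close> for smoothed potentials.\<close>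

lemma increment_lower_bound:
  fixes u :: "real^'n \<Rightarrow> real"
  assumes diff: "\<And>x. u differentiable (at x)"
    and part: "\<And>x i. l i \<le> partial_deriv i u x \<and> partial_deriv i u x \<le> h i"
  shows "(\<Sum>i\<in>UNIV. l i * max (y $ i - x $ i) 0 - h i * max (x $ i - y $ i) 0) \<le> u y - u x"
proof -
  obtain u' where u': "\<And>x. (u has_derivative u' x) (at x)"
    using diff unfolding differentiable_def by metis
  define \<phi> where "\<phi> t = u (x + t *\<^sub>R (y - x))" for t :: real
  have der: "(\<phi> has_derivative (\<lambda>s. u' (x + t *\<^sub>R (y - x)) (s *\<^sub>R (y - x)))) (at t within {0..1})" for t
  proof -
    have "((\<lambda>t. x + t *\<^sub>R (y - x)) has_derivative (\<lambda>s. s *\<^sub>R (y - x))) (at t within {0..1})"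
      by (auto intro!: derivative_eq_intros)
    then show ?thesis
      unfolding \<phi>_def using u' by (rule has_derivative_compose)
  qed
  obtain t where "\<phi> 1 - \<phi> 0 = u' (x + t *\<^sub>R (y - x)) ((1 - 0) *\<^sub>R (y - x))"
    using mvt_simple[of 0 1 \<phi> "\<lambda>t s. u' (x + t *\<^sub>R (y - x)) (s *\<^sub>R (y - x))"] der by auto
  then obtain w where w: "u y - u x = u' w (y - x)"
    by (auto simp: \<phi>_def)
  have lin: "linear (u' w)" using u' by (rule has_derivative_linear)
  have "y - x = (\<Sum>i\<in>UNIV. (y $ i - x $ i) *\<^sub>R axis i 1)"
    using basis_expansion[of "y - x"] by (simp add: scalar_mult_eq_scaleR)
  then have "u' w (y - x) = (\<Sum>i\<in>UNIV. (y $ i - x $ i) * u' w (axis i 1))"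
    using linear_sum[OF lin, of "\<lambda>i. (y $ i - x $ i) *\<^sub>R axis i 1" UNIV] linear_scale[OF lin]
    by simp
  also have "\<dots> = (\<Sum>i\<in>UNIV. (y $ i - x $ i) * partial_deriv i u w)"
    using partial_deriv_eq[OF u'] by simp
  also have "\<dots> \<ge> (\<Sum>i\<in>UNIV. l i * max (y $ i - x $ i) 0 - h i * max (x $ i - y $ i) 0)"
  proof (rule sum_mono)
    fix i
    show "l i * max (y $ i - x $ i) 0 - h i * max (x $ i - y $ i) 0 \<le> (y $ i - x $ i) * partial_deriv i u w"
    proof (cases "x $ i \<le> y $ i")
      case True
      then show ?thesis
        using mult_right_mono[of "l i" "partial_deriv i u w" "y $ i - x $ i"] part[of i w]
        by (simp add: max_def mult.commute)
    next
      case False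
      then show ?thesis
        using mult_right_mono[of "partial_deriv i u w" "h i" "x $ i - y $ i"] part[of i w]
        by (simp add: max_def algebra_simps)
    qed
  qed
  finally show ?thesis using w by simp
qed

definition l1_cost :: "('n \<Rightarrow> real) \<Rightarrow> real^'n \<Rightarrow> real^'n \<Rightarrow> real"
  where "l1_cost \<beta> x y = (\<Sum>i\<in>UNIV. \<beta> i * \<bar>x $ i - y $ i\<bar>)"

text \<open>Two smoothings are composed: the square root \<open>r\<close> for each absolute value
  and a logarithmic soft minimum for \<open>Min\<close>. Neither steepens the function: the
  derivative \<open>t / r t\<close> is at most 1 in absolute value, and the soft minimum averages
  gradients. Hence the slopes are bounded by \<open>\<beta> i\<close> itself, with no error
  term.\<close>

lemma smooth_min_cone_approximation:
  fixes A :: "(real^'n) set" and \<beta> :: "'n \<Rightarrow> real"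
  assumes A: "finite A" "A \<noteq> {}" and \<beta>: "\<And>i. 0 < \<beta> i" and \<epsilon>: "0 < \<epsilon>"
  shows "\<exists>u. (\<forall>x. u differentiable (at x)) \<and> (\<forall>x i. \<bar>partial_deriv i u x\<bar> \<le> \<beta> i) \<and>
    (\<forall>y. \<bar>u y - Min ((\<lambda>a. C a + l1_cost \<beta> a y) ` A)\<bar> \<le> \<epsilon>)"
proof -
  \<comment> \<open>The soft minimum of \<open>card A\<close> terms lies below the minimum by at
    most \<open>ln (card A) / L\<close>, here at most \<open>\<epsilon>\<close>; the summand 1 keeps
    \<open>L\<close> positive when \<open>A\<close> is a singleton.\<close>
  define L where "L = (ln (real (card A)) + 1) / \<epsilon>"
  have card: "1 \<le> card A" using A by (simp add: Suc_leI card_gt_0_iff)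
  then have L: "0 < L" using \<epsilon> by (simp add: L_def add_nonneg_pos)
  define B where "B = sum \<beta> UNIV"
  have B: "0 \<le> B" unfolding B_def using \<beta> by (intro sum_nonneg) (auto intro: less_imp_le)
  \<comment> \<open>Each absolute value is raised by at most \<open>\<delta>\<close>, the weighted
    sum by at most \<open>\<delta> * B\<close>. Adding 1 makes the denominator positive given
    \<open>0 \<le> B\<close>.\<close>
  define \<delta> where "\<delta> = \<epsilon> / (B + 1)"
  have \<delta>: "0 < \<delta>" "\<delta> * B \<le> \<epsilon>"
    using \<epsilon> B by (auto simp: \<delta>_def field_simps)
  define r where "r t = sqrt (t\<^sup>2 + \<delta>\<^sup>2)" for t
  have r_pos: "0 < t\<^sup>2 + \<delta>\<^sup>2" for t using \<delta> by (simp add: add_nonneg_pos)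
  have r_ge: "\<bar>t\<bar> \<le> r t" for t
    unfolding r_def by (rule real_le_rsqrt) simp
  have r_le: "r t \<le> \<bar>t\<bar> + \<delta>" for t
    unfolding r_def using \<delta> by (intro real_le_lsqrt) (auto simp: power2_sum)
  define g where "g a y = C a + (\<Sum>i\<in>UNIV. \<beta> i * r (y $ i - a $ i))" for a y
  define g' where "g' a y v = (\<Sum>i\<in>UNIV. \<beta> i * ((y $ i - a $ i) / r (y $ i - a $ i)) * v $ i)" for a y and v :: "real^'n"
  have g_der: "(g a has_derivative g' a y) (at y)" for a y
  proof -
    have r_der: "(r has_real_derivative t / r t) (at t)" for t
      unfolding r_def using r_pos[of t] by (auto intro!: derivative_eq_intros simp: divide_simps)
    have "((\<lambda>y. y $ i - a $ i) has_derivative (\<lambda>v. v $ i)) (at y)" for i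
      by (auto intro!: derivative_eq_intros bounded_linear_vec_nth[THEN bounded_linear_imp_has_derivative])
    then have "((\<lambda>y. r (y $ i - a $ i)) has_derivative (\<lambda>v. ((y $ i - a $ i) / r (y $ i - a $ i)) * v $ i)) (at y)" for i
      by (rule has_derivative_compose[OF _ r_der[unfolded has_field_derivative_def]])
    then show ?thesis
      unfolding g_def[abs_def] g'_def[abs_def]
      by (auto intro!: derivative_eq_intros simp: mult.assoc)
  qed
  have g_ge: "C a + l1_cost \<beta> a y \<le> g a y" for a y
    unfolding g_def l1_cost_def abs_minus_commute[of "a $ _"] using \<beta> r_ge
    by (auto intro!: sum_mono mult_left_mono simp: less_imp_le)
  have g_le: "g a y \<le> C a + l1_cost \<beta> a y + \<epsilon>" for a y
  proof -
    have "(\<Sum>i\<in>UNIV. \<beta> i * r (y $ i - a $ i)) \<le> (\<Sum>i\<in>UNIV. \<beta> i * (\<bar>y $ i - a $ i\<bar> + \<delta>))"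
      using \<beta> r_le by (auto intro!: sum_mono mult_left_mono simp: less_imp_le)
    also have "\<dots> = l1_cost \<beta> a y + \<delta> * B"
      by (simp add: l1_cost_def B_def algebra_simps sum.distrib sum_distrib_left abs_minus_commute)
    finally show ?thesis using \<delta> by (simp add: g_def)
  qed
  \<comment> \<open>The gradient of a soft minimum is a convex combination of the gradients of the \<open>g a\<close>.\<close>
  define Z where "Z y = (\<Sum>a\<in>A. exp (- L * g a y))" for y
  have Z: "0 < Z y" for y unfolding Z_def using A by (intro sum_pos) auto
  define u where "u y = - (ln (Z y) / L)" for y
  define u' where "u' y v = (\<Sum>a\<in>A. exp (- L * g a y) * g' a y v) / Z y" for y v
  have u_der: "(u has_derivative u' y) (at y)" for y
  proof -
    have "(Z has_derivative (\<lambda>v. \<Sum>a\<in>A. exp (- L * g a y) * (- L * g' a y v))) (at y)"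
      unfolding Z_def[abs_def] by (rule has_derivative_sum, rule derivative_eq_intros, rule derivative_eq_intros g_der)
        (auto intro!: derivative_eq_intros g_der)
    then have "(u has_derivative (\<lambda>v. - ((\<Sum>a\<in>A. exp (- L * g a y) * (- L * g' a y v)) * inverse (Z y) / L))) (at y)"
      unfolding u_def[abs_def] using Z[of y] L by (auto intro!: derivative_eq_intros)
    moreover have "(\<lambda>v. - ((\<Sum>a\<in>A. exp (- L * g a y) * (- L * g' a y v)) * inverse (Z y) / L)) = u' y"
      using L Z by (auto simp: u'_def sum_negf sum_distrib_right sum_divide_distrib fun_eq_iff field_simps intro!: sum.cong)
    ultimately show ?thesis by simp
  qed
  have "\<bar>partial_deriv i u y\<bar> \<le> \<beta> i" for i y
  proof -
    have g'_axis: "g' a y (axis i 1) = \<beta> i * ((y $ i - a $ i) / r (y $ i - a $ i))" for a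
      by (simp add: g'_def axis_def if_distrib cong: if_cong)
    have bound: "\<bar>g' a y (axis i 1)\<bar> \<le> \<beta> i" for a
    proof -
      have "0 < r (y $ i - a $ i)" unfolding r_def using r_pos by simp
      then have "\<bar>(y $ i - a $ i) / r (y $ i - a $ i)\<bar> \<le> 1"
        using r_ge[of "y $ i - a $ i"] by (simp add: abs_divide)
      from mult_left_mono[OF this, of "\<beta> i"] show ?thesis
        unfolding g'_axis abs_mult using \<beta>[of i] by simp
    qed
    have "\<bar>\<Sum>a\<in>A. exp (- L * g a y) * g' a y (axis i 1)\<bar> \<le> (\<Sum>a\<in>A. exp (- L * g a y) * \<beta> i)"
      by (rule order_trans[OF sum_abs]) (auto intro!: sum_mono mult_left_mono bound simp: abs_mult)
    also have "\<dots> = \<beta> i * Z y" by (simp add: Z_def sum_distrib_left mult.commute)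
    finally show ?thesis
      unfolding partial_deriv_eq[OF u_der] u'_def using Z[of y] by (simp add: abs_divide pos_divide_le_eq)
  qed
  \<comment> \<open>The errors have opposite signs: \<open>g a\<close> exceeds its cone by at most
    \<open>\<epsilon>\<close>, while the soft minimum undercuts the least \<open>g a\<close> by at
    most \<open>\<epsilon>\<close>. So they do not add up.\<close>
  moreover have "\<bar>u y - Min ((\<lambda>a. C a + l1_cost \<beta> a y) ` A)\<bar> \<le> \<epsilon>" for y
  proof -
    let ?h = "\<lambda>a. C a + l1_cost \<beta> a y"
    let ?m = "Min (?h ` A)"
    have "?m \<in> ?h ` A" using A by (intro Min_in) auto
    then obtain a where a: "a \<in> A" "?m = ?h a" by auto
    have "exp (- L * g a y) \<le> Z y"
      unfolding Z_def using A a by (intro member_le_sum) auto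
    then have "- L * g a y \<le> ln (Z y)" using Z by (simp add: ln_ge_iff)
    then have "u y \<le> g a y" using L by (simp add: u_def field_simps)
    then have "u y \<le> ?m + \<epsilon>" using g_le[of a y] a by simp
    moreover have "?m - \<epsilon> \<le> u y"
    proof -
      have "Z y \<le> (\<Sum>a\<in>A. exp (- L * ?m))"
        unfolding Z_def
      proof (rule sum_mono)
        fix a assume "a \<in> A"
        then have "?m \<le> ?h a" using A by simp
        then show "exp (- L * g a y) \<le> exp (- L * ?m)" using g_ge[of a y] L by simp
      qed
      also have "\<dots> = exp (ln (real (card A)) - L * ?m)"
        using card by (simp add: exp_diff exp_minus field_simps)
      finally have "ln (Z y) \<le> ln (real (card A)) - L * ?m"
        using Z[of y] by (metis exp_gt_zero ln_exp ln_le_cancel_iff)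
      then have "ln (Z y) / L \<le> (ln (real (card A)) - L * ?m) / L"
        using L by (intro divide_right_mono) auto
      then have "?m - ln (real (card A)) / L \<le> u y" using L by (simp add: u_def diff_divide_distrib)
      moreover have "ln (real (card A)) / L \<le> \<epsilon>"
      proof -
        have "ln (real (card A)) \<le> \<epsilon> * L" using \<epsilon> by (simp add: L_def)
        then show ?thesis using L by (simp add: field_simps)
      qed
      ultimately show ?thesis by simp
    qed
    ultimately show ?thesis by simp
  qed
  ultimately show ?thesis
    using u_der unfolding differentiable_def by blast
qed

section \<open>Comparison of integrals through distribution functions\<close>

text \<open>Fubini for the indicator of \<open>R t (h x)\<close>. Of \<open>R\<close> it matters
  that \<open>{t. R t s}\<close> has the positive part of \<open>s\<close> as its length, so strict
  and non-strict level sets are covered alike.\<close>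

lemma nn_integral_layer_cake:
  fixes h :: "'a \<Rightarrow> real" and R :: "real \<Rightarrow> real \<Rightarrow> bool"
  assumes "sigma_finite_measure M" and [measurable]: "h \<in> borel_measurable M"
    and [measurable]: "Measurable.pred (borel \<Otimes>\<^sub>M borel) (\<lambda>z. R (fst z) (snd z))"
    and R: "\<And>s. emeasure lborel {t. R t s} = ennreal s"
  shows "(\<integral>\<^sup>+x. ennreal (h x) \<partial>M) = (\<integral>\<^sup>+t. emeasure M {x\<in>space M. R t (h x)} \<partial>lborel)"
proof -
  interpret pair_sigma_finite M lborel
    using assms(1) by (simp add: pair_sigma_finite_def lborel.sigma_finite_measure_axioms)
  have "(\<lambda>z. (snd z, h (fst z))) \<in> M \<Otimes>\<^sub>M lborel \<rightarrow>\<^sub>M borel \<Otimes>\<^sub>M borel"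
    by measurable
  from measurable_compose[OF this assms(3)]
  have [measurable]: "Measurable.pred (M \<Otimes>\<^sub>M lborel) (\<lambda>z. R (snd z) (h (fst z)))"
    by simp
  have "{t. R t s} \<in> sets lborel" for s
    using measurable_compose[OF measurable_Pair2' assms(3), of s] by (simp add: pred_def)
  then have "(\<integral>\<^sup>+x. ennreal (h x) \<partial>M) = (\<integral>\<^sup>+x. \<integral>\<^sup>+t. indicator {t. R t (h x)} t \<partial>lborel \<partial>M)"
    by (intro nn_integral_cong) (simp add: R[symmetric])
  also have "\<dots> = (\<integral>\<^sup>+t. \<integral>\<^sup>+x. indicator {t. R t (h x)} t \<partial>M \<partial>lborel)"
    by (rule Fubini'[symmetric]) measurable
  also have "\<dots> = (\<integral>\<^sup>+t. \<integral>\<^sup>+x. indicator {x\<in>space M. R t (h x)} x \<partial>M \<partial>lborel)"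
    by (intro nn_integral_cong) (auto split: split_indicator)
  also have "\<dots> = (\<integral>\<^sup>+t. emeasure M {x\<in>space M. R t (h x)} \<partial>lborel)"
  proof (intro nn_integral_cong nn_integral_indicator)
    fix t :: real
    have "(\<lambda>x. (t, h x)) \<in> M \<rightarrow>\<^sub>M borel \<Otimes>\<^sub>M borel" by measurable
    from measurable_compose[OF this assms(3)] show "{x\<in>space M. R t (h x)} \<in> sets M"
      by (simp add: pred_def)
  qed
  finally show ?thesis .
qed

text \<open>The hypothesis speaks of the sets \<open>g x \<le> t\<close> only. The positive part is
  therefore layered by their complements \<open>t < g x\<close>, and the negative part by
  \<open>g x \<le> - t\<close>.\<close>

lemma integral_mono_cdf:
  fixes g :: "'a \<Rightarrow> real"
  assumes P: "prob_space P" and Q: "prob_space Q" and sets: "sets P = sets Q"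
    and gP: "integrable P g" and gQ: "integrable Q g"
    and cdf: "\<And>t. measure Q {x\<in>space Q. g x \<le> t} \<le> measure P {x\<in>space P. g x \<le> t}"
  shows "(LINT x|P. g x) \<le> (LINT x|Q. g x)"
proof -
  interpret P: prob_space P by fact
  interpret Q: prob_space Q by fact
  have space: "space P = space Q" using sets by (rule sets_eq_imp_space_eq)
  have [measurable]: "g \<in> borel_measurable P" "g \<in> borel_measurable Q" using gP gQ by auto
  have strict: "emeasure P {x\<in>space P. t < g x} \<le> emeasure Q {x\<in>space Q. t < g x}" for t
  proof -
    have "measure P {x\<in>space P. t < g x} = 1 - measure P {x\<in>space P. g x \<le> t}"
      by (subst P.prob_compl[symmetric]) (auto intro!: arg_cong[where f="measure P"])
    moreover have "measure Q {x\<in>space Q. t < g x} = 1 - measure Q {x\<in>space Q. g x \<le> t}"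
      by (subst Q.prob_compl[symmetric]) (auto intro!: arg_cong[where f="measure Q"])
    ultimately show ?thesis using cdf[of t]
      by (simp add: P.emeasure_eq_measure Q.emeasure_eq_measure)
  qed
  have pos: "(\<integral>\<^sup>+x. ennreal (g x) \<partial>P) \<le> (\<integral>\<^sup>+x. ennreal (g x) \<partial>Q)"
  proof -
    have R: "emeasure lborel {t::real. 0 \<le> t \<and> t < s} = ennreal s" for s
    proof (cases "0 \<le> s")
      case True
      have "{t::real. 0 \<le> t \<and> t < s} = {0..<s}" by auto
      then show ?thesis using True by simp
    next
      case False
      then have E: "{t::real. 0 \<le> t \<and> t < s} = {}" by auto
      show ?thesis unfolding E using False by (simp add: ennreal_neg)
    qed
    have "(\<integral>\<^sup>+x. ennreal (g x) \<partial>M) = (\<integral>\<^sup>+t. emeasure M {x\<in>space M. 0 \<le> t \<and> t < g x} \<partial>lborel)"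
      if "prob_space M" "g \<in> borel_measurable M" for M
    proof -
      interpret prob_space M by fact
      show ?thesis using that(2) R
        by (intro nn_integral_layer_cake) (auto intro: sigma_finite_measure_axioms)
    qed
    moreover have "emeasure P {x\<in>space P. 0 \<le> t \<and> t < g x} \<le> emeasure Q {x\<in>space Q. 0 \<le> t \<and> t < g x}" for t
      using strict[of t] by (cases "0 \<le> t") auto
    ultimately show ?thesis
      using P Q by (auto intro!: nn_integral_mono)
  qed
  have neg: "(\<integral>\<^sup>+x. ennreal (- g x) \<partial>Q) \<le> (\<integral>\<^sup>+x. ennreal (- g x) \<partial>P)"
  proof -
    have R: "emeasure lborel {t::real. 0 < t \<and> t \<le> s} = ennreal s" for s
    proof (cases "0 \<le> s")
      case True
      have "{t::real. 0 < t \<and> t \<le> s} = {0<..s}" by auto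
      then show ?thesis using True by simp
    next
      case False
      then have E: "{t::real. 0 < t \<and> t \<le> s} = {}" by auto
      show ?thesis unfolding E using False by (simp add: ennreal_neg)
    qed
    have "(\<integral>\<^sup>+x. ennreal (- g x) \<partial>M) = (\<integral>\<^sup>+t. emeasure M {x\<in>space M. 0 < t \<and> t \<le> - g x} \<partial>lborel)"
      if "prob_space M" "g \<in> borel_measurable M" for M
    proof -
      interpret prob_space M by fact
      show ?thesis using that(2) R
        by (intro nn_integral_layer_cake) (auto intro: sigma_finite_measure_axioms)
    qed
    moreover have "emeasure Q {x\<in>space Q. 0 < t \<and> t \<le> - g x} \<le> emeasure P {x\<in>space P. 0 < t \<and> t \<le> - g x}" for t
    proof (cases "0 < t")
      case True
      have "{x\<in>space M. 0 < t \<and> t \<le> - g x} = {x\<in>space M. g x \<le> - t}" for M :: "'a measure"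
        using True by auto
      then show ?thesis using cdf[of "-t"]
        by (simp add: P.emeasure_eq_measure Q.emeasure_eq_measure)
    qed simp
    ultimately show ?thesis
      using P Q by (auto intro!: nn_integral_mono)
  qed
  have fin: "(\<integral>\<^sup>+x. ennreal (g x) \<partial>Q) \<noteq> \<infinity>" "(\<integral>\<^sup>+x. ennreal (- g x) \<partial>P) \<noteq> \<infinity>"
    using gP gQ by (auto simp: real_integrable_def)
  show ?thesis
    unfolding real_lebesgue_integral_def[OF gP] real_lebesgue_integral_def[OF gQ]
    using pos neg fin by (intro diff_mono enn2real_mono) (auto simp: top.not_eq_extremum)
qed

section \<open>The weighted cost\<close>

lemma l1_cost_nonneg: "(\<And>i. 0 < \<beta> i) \<Longrightarrow> 0 \<le> l1_cost \<beta> x y"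
  by (auto simp: l1_cost_def less_imp_le intro!: sum_nonneg)

lemma l1_cost_refl: "l1_cost \<beta> x x = 0"
  by (simp add: l1_cost_def)

lemma l1_cost_commute: "l1_cost \<beta> x y = l1_cost \<beta> y x"
  by (simp add: l1_cost_def abs_minus_commute)

lemma l1_cost_triangle:
  assumes "\<And>i. 0 < \<beta> i"
  shows "l1_cost \<beta> x z \<le> l1_cost \<beta> x y + l1_cost \<beta> y z"
  unfolding l1_cost_def sum.distrib[symmetric] distrib_left[symmetric]
  using assms by (intro sum_mono mult_left_mono) (auto simp: less_imp_le)

lemma l1_cost_le_norm:
  fixes x y :: "real^'n"
  assumes "\<And>i. 0 < \<beta> i"
  shows "l1_cost \<beta> x y \<le> sum \<beta> UNIV * norm (x - y)"
  unfolding l1_cost_def sum_distrib_right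
proof (rule sum_mono)
  fix i
  show "\<beta> i * \<bar>x $ i - y $ i\<bar> \<le> \<beta> i * norm (x - y)"
    using component_le_norm_cart[of "x - y" i] assms[of i] by (intro mult_left_mono) auto
qed

lemma l1_cost_lipschitz:
  fixes x y x' y' :: "real^'n"
  assumes \<beta>: "\<And>i. 0 < \<beta> i"
  shows "\<bar>l1_cost \<beta> x y - l1_cost \<beta> x' y'\<bar> \<le> sum \<beta> UNIV * (norm (x - x') + norm (y - y'))"
proof -
  note tri = l1_cost_triangle[of \<beta>, OF \<beta>]
  have "\<bar>l1_cost \<beta> x y - l1_cost \<beta> x' y'\<bar> \<le> l1_cost \<beta> x x' + l1_cost \<beta> y y'"
    using tri[of x y x'] tri[of x' y y'] tri[of x' y' x] tri[of x y' y]
    by (simp add: l1_cost_commute[of \<beta> x' x] l1_cost_commute[of \<beta> y' y])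
  also have "\<dots> \<le> sum \<beta> UNIV * (norm (x - x') + norm (y - y'))"
    unfolding distrib_left by (intro add_mono l1_cost_le_norm \<beta>)
  finally show ?thesis .
qed

definition weighted_sum :: "('n \<Rightarrow> real) \<Rightarrow> real^'n \<Rightarrow> real"
  where "weighted_sum \<beta> x = (\<Sum>i\<in>UNIV. \<beta> i * x $ i)"

lemma positive_part_cost:
  "(\<Sum>i\<in>UNIV. \<beta> i * max (x $ i - y $ i) 0) =
    (l1_cost \<beta> x y - (weighted_sum \<beta> y - weighted_sum \<beta> x)) / 2"
proof -
  have "2 * (\<Sum>i\<in>UNIV. \<beta> i * max (x $ i - y $ i) 0) =
    (\<Sum>i\<in>UNIV. \<beta> i * \<bar>x $ i - y $ i\<bar> - (\<beta> i * y $ i - \<beta> i * x $ i))"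
    unfolding sum_distrib_left by (intro sum.cong refl) (simp add: max_def abs_if algebra_simps)
  then show ?thesis by (simp add: l1_cost_def weighted_sum_def sum_subtractf)
qed

lemma negative_part_cost:
  "(\<Sum>i\<in>UNIV. \<beta> i * max (y $ i - x $ i) 0) =
    (l1_cost \<beta> x y + (weighted_sum \<beta> y - weighted_sum \<beta> x)) / 2"
  unfolding positive_part_cost[of \<beta> y x] l1_cost_commute[of \<beta> y x] by simp

lemma weighted_sum_one_lipschitz:
  assumes "\<And>i. 0 < \<beta> i"
  shows "weighted_sum \<beta> y - weighted_sum \<beta> x \<le> l1_cost \<beta> x y"
proof -
  have "0 \<le> (\<Sum>i\<in>UNIV. \<beta> i * max (x $ i - y $ i) 0)"
    using assms by (intro sum_nonneg) (simp add: less_imp_le)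
  then show ?thesis by (simp add: positive_part_cost)
qed

text \<open>The two sides differ by twice the weighted sum of \<open>max (x $ i - y $ i) 0\<close>,
  which vanishes exactly when every summand does, as the weights are positive.\<close>

lemma l1_cost_eq_weighted_sum_iff:
  assumes "\<And>i. 0 < \<beta> i"
  shows "l1_cost \<beta> x y = weighted_sum \<beta> y - weighted_sum \<beta> x \<longleftrightarrow> x \<le> y"
proof -
  have "l1_cost \<beta> x y = weighted_sum \<beta> y - weighted_sum \<beta> x \<longleftrightarrow>
      (\<Sum>i\<in>UNIV. \<beta> i * max (x $ i - y $ i) 0) = 0"
    by (simp add: positive_part_cost)
  also have "\<dots> \<longleftrightarrow> (\<forall>i. \<beta> i * max (x $ i - y $ i) 0 = 0)"
    using assms by (subst sum_nonneg_eq_0_iff) (auto simp: less_imp_le)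
  also have "\<dots> \<longleftrightarrow> x \<le> y"
  proof -
    have "\<beta> i \<noteq> 0" for i using assms[of i] by simp
    then show ?thesis by (simp add: less_eq_vec_def max_def)
  qed
  finally show ?thesis .
qed

section \<open>Measures carried by \<open>D\<close> and the stated equivalences\<close>

lemma set_integral_full_measure:
  fixes g :: "'a \<Rightarrow> real"
  assumes [measurable]: "D \<in> sets M" "g \<in> borel_measurable M" and "AE x in M. x \<in> D"
  shows "(LINT x:D|M. g x) = (LINT x|M. g x)"
  unfolding set_lebesgue_integral_def
proof (rule integral_cong_AE)
  show "AE x in M. indicator D x *\<^sub>R g x = g x" using assms(3) by eventually_elim simp
qed measurable

theorem corollary2p9:
  fixes D :: "(real^'n) set" and P Q :: "(real^'n) measure" and \<beta> :: "'n \<Rightarrow> real"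
  assumes "D \<noteq> {}" and "D \<in> sets borel"
    and "prob_space P" and "sets P = sets borel" and "measure P D = 1"
    and "prob_space Q" and "sets Q = sets borel" and "measure Q D = 1"
    and "integrable P norm" and "integrable Q norm"
    and "\<And>i. \<beta> i > 0"
  shows "(\<forall>\<gamma>. 0 < \<gamma> \<and> \<gamma> \<le> 1 \<longrightarrow>
            (CSD D \<gamma> \<beta> P Q \<longleftrightarrow> MASD D \<gamma> \<beta> P Q) \<and>
            (MASD D \<gamma> \<beta> P Q \<longleftrightarrow> mean_diff D \<beta> P Q \<ge> (1 - \<gamma>) / (1 + \<gamma>) * W1 D \<beta> P Q)) \<and>
         (FOSD P Q \<longleftrightarrow> mean_diff D \<beta> P Q = W1 D \<beta> P Q)"
proof -
  note \<beta> = assms(11)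
  note [measurable] = assms(2)
  have [measurable]: "(\<lambda>x::real^'n. x $ i) \<in> borel_measurable borel" for i
    by (intro borel_measurable_continuous_onI continuous_intros)
  let ?c = "l1_cost \<beta>" and ?b = "weighted_sum \<beta>"
  interpret transport_problem P Q ?c "sum \<beta> UNIV"
  proof (intro transport_problem.intro marginals.intro transport_problem_axioms.intro)
    show "(\<lambda>z. ?c (fst z) (snd z)) \<in> borel_measurable (borel \<Otimes>\<^sub>M borel)"
      unfolding l1_cost_def by measurable
  qed (fact assms l1_cost_refl | rule l1_cost_nonneg l1_cost_triangle l1_cost_lipschitz, rule \<beta>)+
  have D_P: "AE x in P. x \<in> D" and D_Q: "AE x in Q. x \<in> D"
    using assms P.AE_in_set_eq_1[of D] Q.AE_in_set_eq_1[of D] by auto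
  have setP: "(LINT x:D|P. g x) = (LINT x|P. g x)" if [measurable]: "g \<in> borel_measurable borel" for g :: "real^'n \<Rightarrow> real"
    using D_P assms(2) sets_P by (intro set_integral_full_measure) auto
  have setQ: "(LINT x:D|Q. g x) = (LINT x|Q. g x)" if [measurable]: "g \<in> borel_measurable borel" for g :: "real^'n \<Rightarrow> real"
    using D_Q assms(2) sets_Q by (intro set_integral_full_measure) auto
  have set\<kappa>: "(LINT z:D \<times> D|\<kappa>. g z) = (LINT z|\<kappa>. g z)"
    if \<kappa>: "\<kappa> \<in> couplings P Q" and g[measurable]: "g \<in> borel_measurable (borel \<Otimes>\<^sub>M borel)" for \<kappa> and g :: "_ \<Rightarrow> real"
  proof (rule set_integral_full_measure)
    have s[measurable_cong]: "sets \<kappa> = sets (borel \<Otimes>\<^sub>M borel)" using \<kappa> by (rule sets_coupling)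
    show "D \<times> D \<in> sets \<kappa>" unfolding s by measurable
    show "g \<in> borel_measurable \<kappa>" by measurable
    have "AE z in \<kappa>. fst z \<in> D" "AE z in \<kappa>. snd z \<in> D"
      using D_P D_Q \<kappa> AE_distr_iff[of fst \<kappa> borel "\<lambda>x. x \<in> D"] AE_distr_iff[of snd \<kappa> borel "\<lambda>x. x \<in> D"]
      by (auto simp: couplings_def)
    then show "AE z in \<kappa>. z \<in> D \<times> D" by eventually_elim (auto simp: mem_Times_iff)
  qed
  define I where "I \<kappa> = (LINT z|\<kappa>. ?c (fst z) (snd z))" for \<kappa>
  define \<Delta> where "\<Delta> = mean_diff D \<beta> P Q"
  define W where "W = W1 D \<beta> P Q"
  obtain \<kappa>0 where \<kappa>0: "\<kappa>0 \<in> couplings P Q" and opt: "\<And>\<eta>. \<eta> \<in> couplings P Q \<Longrightarrow> I \<kappa>0 \<le> I \<eta>"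
    using optimal_coupling_exists unfolding I_def by blast
  have "W = (INF \<kappa>\<in>couplings P Q. I \<kappa>)"
    unfolding W_def W1_def I_def l1_cost_def[symmetric] by (intro INF_cong refl set\<kappa>) measurable
  also have "\<dots> = I \<kappa>0"
    using \<kappa>0 opt by (intro cInf_eq_minimum) auto
  finally have W: "W = I \<kappa>0" .
  have b_lip: "?b y - ?b x \<le> ?c x y" for x y using \<beta> by (rule weighted_sum_one_lipschitz)
  note b_meas[measurable] = one_lipschitz_measurable[OF b_lip]
  note b_int = one_lipschitz_integrable_P[OF b_lip] one_lipschitz_integrable_Q[OF b_lip]
  have \<Delta>: "\<Delta> = (LINT y|Q. ?b y) - (LINT x|P. ?b x)"
    unfolding \<Delta>_def mean_diff_def weighted_sum_def[symmetric] using setP[OF b_meas] setQ[OF b_meas] by simp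
  have coupled_diff: "integrable \<kappa> (\<lambda>z. f (snd z) - f (fst z)) \<and>
      (LINT z|\<kappa>. f (snd z) - f (fst z)) = (LINT y|Q. f y) - (LINT x|P. f x)"
    if \<kappa>: "\<kappa> \<in> couplings P Q" and f: "\<And>x y. f y - f x \<le> ?c x y" for \<kappa> f
    using integrable_coupling_fst[OF \<kappa>, of f] integrable_coupling_snd[OF \<kappa>, of f]
      integral_coupling_fst[OF \<kappa>, of f] integral_coupling_snd[OF \<kappa>, of f]
      one_lipschitz_measurable[OF f] one_lipschitz_integrable_P[OF f] one_lipschitz_integrable_Q[OF f] by simp
  have \<Delta>\<kappa>: "integrable \<kappa> (\<lambda>z. ?b (snd z) - ?b (fst z))" "(LINT z|\<kappa>. ?b (snd z) - ?b (fst z)) = \<Delta>"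
    if "\<kappa> \<in> couplings P Q" for \<kappa>
    using coupled_diff[OF that b_lip] \<Delta> by auto
  have \<Delta>_le: "\<Delta> \<le> W"
    using weak_duality[OF \<kappa>0 b_lip] by (simp add: \<Delta> W I_def)
  have loss: "(LINT z:D \<times> D|\<kappa>. (\<Sum>i\<in>UNIV. \<beta> i * max (fst z $ i - snd z $ i) 0)) = (I \<kappa> - \<Delta>) / 2"
    and gain: "(LINT z:D \<times> D|\<kappa>. (\<Sum>i\<in>UNIV. \<beta> i * max (snd z $ i - fst z $ i) 0)) = (I \<kappa> + \<Delta>) / 2"
    if \<kappa>: "\<kappa> \<in> couplings P Q" for \<kappa>
  proof -
    note int = integrable_cost[OF \<kappa>] \<Delta>\<kappa>(1)[OF \<kappa>]
    have "(LINT z:D \<times> D|\<kappa>. (\<Sum>i\<in>UNIV. \<beta> i * max (fst z $ i - snd z $ i) 0)) =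
        (LINT z|\<kappa>. (?c (fst z) (snd z) - (?b (snd z) - ?b (fst z))) / 2)"
      unfolding positive_part_cost by (rule set\<kappa>[OF \<kappa>]) measurable
    also have "\<dots> = (I \<kappa> - \<Delta>) / 2"
      using Bochner_Integration.integral_diff[OF int] \<Delta>\<kappa>(2)[OF \<kappa>] by (simp add: I_def)
    finally show "(LINT z:D \<times> D|\<kappa>. (\<Sum>i\<in>UNIV. \<beta> i * max (fst z $ i - snd z $ i) 0)) = (I \<kappa> - \<Delta>) / 2" .
    have "(LINT z:D \<times> D|\<kappa>. (\<Sum>i\<in>UNIV. \<beta> i * max (snd z $ i - fst z $ i) 0)) =
        (LINT z|\<kappa>. (?c (fst z) (snd z) + (?b (snd z) - ?b (fst z))) / 2)"
      unfolding negative_part_cost by (rule set\<kappa>[OF \<kappa>]) measurable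
    also have "\<dots> = (I \<kappa> + \<Delta>) / 2"
      using Bochner_Integration.integral_add[OF int] \<Delta>\<kappa>(2)[OF \<kappa>] by (simp add: I_def)
    finally show "(LINT z:D \<times> D|\<kappa>. (\<Sum>i\<in>UNIV. \<beta> i * max (snd z $ i - fst z $ i) 0)) = (I \<kappa> + \<Delta>) / 2" .
  qed
  have dual: "\<exists>A C. finite A \<and> A \<noteq> {} \<and> W \<le> (LINT y|Q. min_cone A C y) - (LINT x|P. min_cone A C x) + \<epsilon>"
    if "0 < \<epsilon>" for \<epsilon>
    using approximate_duality[OF that] opt unfolding W I_def[symmetric] by (meson order_trans)
  have equiv: "(CSD D \<gamma> \<beta> P Q \<longleftrightarrow> MASD D \<gamma> \<beta> P Q) \<and>
      (MASD D \<gamma> \<beta> P Q \<longleftrightarrow> (1 - \<gamma>) / (1 + \<gamma>) * W \<le> \<Delta>)" if \<gamma>: "0 < \<gamma>" "\<gamma> \<le> 1" for \<gamma>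
  proof -
    have ineq: "(1 - \<gamma>) / (1 + \<gamma>) * W \<le> \<Delta> \<longleftrightarrow> (1 - \<gamma>) * W \<le> (1 + \<gamma>) * \<Delta>"
      using \<gamma> by (simp add: field_simps)
    have half: "(a - \<Delta>) / 2 \<le> \<gamma> * ((a + \<Delta>) / 2) \<longleftrightarrow> (1 - \<gamma>) * a \<le> (1 + \<gamma>) * \<Delta>" for a
    proof -
      have le_iff: "x \<le> y \<longleftrightarrow> 0 \<le> 2 * (y - x)" for x y :: real by simp
      have eq: "2 * (\<gamma> * ((a + \<Delta>) / 2) - (a - \<Delta>) / 2) = (1 + \<gamma>) * \<Delta> - (1 - \<gamma>) * a"
        by (simp add: field_simps)
      show ?thesis unfolding le_iff[of "(a - \<Delta>) / 2"] eq by simp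
    qed
    have CSD: "CSD D \<gamma> \<beta> P Q \<longleftrightarrow> (\<exists>\<kappa>\<in>couplings P Q. (1 - \<gamma>) * I \<kappa> \<le> (1 + \<gamma>) * \<Delta>)"
      unfolding CSD_def by (intro bex_cong refl) (simp only: loss gain half)
    have 1: "CSD D \<gamma> \<beta> P Q" if "(1 - \<gamma>) / (1 + \<gamma>) * W \<le> \<Delta>"
      using that \<kappa>0 ineq unfolding CSD W by blast
    have 2: "MASD D \<gamma> \<beta> P Q" if csd: "CSD D \<gamma> \<beta> P Q"
      unfolding MASD_def
    proof (intro allI impI, elim conjE)
      fix u :: "real^'n \<Rightarrow> real"
      assume diff: "\<forall>x. u differentiable (at x)"
        and part: "\<forall>x i. \<gamma> * \<beta> i \<le> partial_deriv i u x \<and> partial_deriv i u x \<le> \<beta> i"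
      obtain \<kappa> where \<kappa>: "\<kappa> \<in> couplings P Q" and le: "(1 - \<gamma>) * I \<kappa> \<le> (1 + \<gamma>) * \<Delta>"
        using csd CSD by blast
      \<comment> \<open>The mean value bound, read as \<open>\<gamma>\<close> times the gain minus
        the loss of the move from \<open>x\<close> to \<open>y\<close>; its integral against
        \<open>\<kappa>\<close> is nonnegative by CSD.\<close>
      have incr: "\<gamma> * ((?c x y + (?b y - ?b x)) / 2) - (?c x y - (?b y - ?b x)) / 2 \<le> u y - u x" for x y
      proof -
        have "(\<Sum>i\<in>UNIV. \<gamma> * \<beta> i * max (y $ i - x $ i) 0 - \<beta> i * max (x $ i - y $ i) 0) \<le> u y - u x"
          using diff part by (intro increment_lower_bound) auto
        also have "(\<Sum>i\<in>UNIV. \<gamma> * \<beta> i * max (y $ i - x $ i) 0 - \<beta> i * max (x $ i - y $ i) 0) =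
            \<gamma> * (\<Sum>i\<in>UNIV. \<beta> i * max (y $ i - x $ i) 0) - (\<Sum>i\<in>UNIV. \<beta> i * max (x $ i - y $ i) 0)"
          by (simp add: sum_subtractf sum_distrib_left mult.assoc)
        finally show ?thesis unfolding negative_part_cost[of \<beta> y x] positive_part_cost[of \<beta> x y] .
      qed
      \<comment> \<open>Exchanging \<open>x\<close> and \<open>y\<close> in \<open>incr\<close> and
        dropping the nonnegative gain leaves the loss of the reverse move, at most the full cost. So
        \<open>u\<close> is 1-Lipschitz for the cost, hence integrable.\<close>
      have u_lip: "u y - u x \<le> ?c x y" for x y
      proof -
        have "0 \<le> \<gamma> * ((?c y x + (?b x - ?b y)) / 2)"
          using \<gamma> b_lip[of y x] b_lip[of x y] by (intro mult_nonneg_nonneg) (auto simp: l1_cost_commute)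
        moreover have "(?c y x - (?b x - ?b y)) / 2 \<le> ?c x y"
          using b_lip[of y x] b_lip[of x y] by (simp add: l1_cost_commute[of \<beta> y x])
        ultimately show ?thesis using incr[of y x] by linarith
      qed
      note ud = coupled_diff[OF \<kappa> u_lip]
      note int = integrable_cost[OF \<kappa>] \<Delta>\<kappa>(1)[OF \<kappa>]
      have "0 \<le> \<gamma> * ((I \<kappa> + \<Delta>) / 2) - (I \<kappa> - \<Delta>) / 2"
        using le half[of "I \<kappa>"] by simp
      also have "\<dots> = (LINT z|\<kappa>. \<gamma> * ((?c (fst z) (snd z) + (?b (snd z) - ?b (fst z))) / 2)
          - (?c (fst z) (snd z) - (?b (snd z) - ?b (fst z))) / 2)"
        using Bochner_Integration.integral_diff[OF int] Bochner_Integration.integral_add[OF int]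
          Bochner_Integration.integrable_diff[OF int] Bochner_Integration.integrable_add[OF int] \<Delta>\<kappa>(2)[OF \<kappa>]
        by (subst Bochner_Integration.integral_diff) (auto simp: I_def simp del: Bochner_Integration.integral_diff Bochner_Integration.integral_add)
      also have "\<dots> \<le> (LINT z|\<kappa>. u (snd z) - u (fst z))"
      proof (rule integral_mono)
        show "integrable \<kappa> (\<lambda>z. \<gamma> * ((?c (fst z) (snd z) + (?b (snd z) - ?b (fst z))) / 2)
            - (?c (fst z) (snd z) - (?b (snd z) - ?b (fst z))) / 2)"
          using Bochner_Integration.integrable_add[OF int] Bochner_Integration.integrable_diff[OF int]
          by (rule Bochner_Integration.integrable_diff[OF integrable_mult_right[OF integrable_divide] integrable_divide])
      qed (use ud incr in auto)
      also have "\<dots> = (LINT y|Q. u y) - (LINT x|P. u x)" using ud by blast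
      finally show "(LINT x:D|P. u x) \<le> (LINT x:D|Q. u x)"
        using setP[OF one_lipschitz_measurable[OF u_lip]] setQ[OF one_lipschitz_measurable[OF u_lip]] by simp
    qed
    have 3: "(1 - \<gamma>) / (1 + \<gamma>) * W \<le> \<Delta>" if masd: "MASD D \<gamma> \<beta> P Q"
      unfolding ineq
    proof (rule field_le_epsilon)
      fix e :: real assume "0 < e"
      \<comment> \<open>Three losses of \<open>\<epsilon>\<close>: one in the dual value, and one in
        each of the two integrals when \<open>min_cone\<close> is replaced by its smoothing
        \<open>v\<close>.\<close>
      define \<epsilon> where "\<epsilon> = e / 3"
      have \<epsilon>: "0 < \<epsilon>" using \<open>0 < e\<close> by (simp add: \<epsilon>_def)
      obtain A C where A: "finite A" "A \<noteq> {}"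
        and WA: "W \<le> (LINT y|Q. min_cone A C y) - (LINT x|P. min_cone A C x) + \<epsilon>"
        using dual[OF \<epsilon>] by blast
      have f_lip: "min_cone A C y - min_cone A C x \<le> ?c x y" for x y
        using A by (rule min_cone_one_lipschitz)
      obtain v where v_diff: "\<And>x. v differentiable (at x)" and v_part: "\<And>x i. \<bar>partial_deriv i v x\<bar> \<le> \<beta> i"
        and v_close: "\<And>y. \<bar>v y - min_cone A C y\<bar> \<le> \<epsilon>"
        using smooth_min_cone_approximation[OF A, of \<beta> \<epsilon> C] \<beta> \<epsilon> unfolding min_cone_def by blast
      have v_lip: "v y - v x \<le> ?c x y" for x y
      proof -
        have "- \<beta> i \<le> partial_deriv i v w \<and> partial_deriv i v w \<le> \<beta> i" for i w
          using v_part[of i w] by linarith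
        then have "(\<Sum>i\<in>UNIV. - \<beta> i * max (x $ i - y $ i) 0 - \<beta> i * max (y $ i - x $ i) 0) \<le> v x - v y"
          using v_diff by (intro increment_lower_bound) auto
        also have "(\<Sum>i\<in>UNIV. - \<beta> i * max (x $ i - y $ i) 0 - \<beta> i * max (y $ i - x $ i) 0) = - ?c x y"
          unfolding l1_cost_def sum_negf[symmetric] by (intro sum.cong refl) (simp add: max_def abs_if algebra_simps)
        finally show ?thesis by simp
      qed
      \<comment> \<open>\<open>(1 + \<gamma>) / 2\<close> and \<open>(1 - \<gamma>) / 2\<close> are
        the midpoint and the half-length of the interval from \<open>\<gamma>\<close> to 1. As
        \<open>?b\<close> has slopes \<open>\<beta> i\<close> and \<open>v\<close> has slopes
        between \<open>- \<beta> i\<close> and \<open>\<beta> i\<close>, the slopes of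
        \<open>u\<close> lie exactly in the range that MASD prescribes. The minus sign turns the
        MASD inequality into an upper bound on the dual value of \<open>v\<close>.\<close>
      define u where "u x = (1 + \<gamma>) / 2 * ?b x - (1 - \<gamma>) / 2 * v x" for x
      obtain v' where v': "\<And>x. (v has_derivative v' x) (at x)"
        using v_diff unfolding differentiable_def by metis
      have b': "(?b has_derivative ?b) (at x)" for x
        unfolding weighted_sum_def[abs_def]
        by (auto intro!: derivative_eq_intros bounded_linear_vec_nth[THEN bounded_linear_imp_has_derivative])
      have u': "(u has_derivative (\<lambda>h. (1 + \<gamma>) / 2 * ?b h - (1 - \<gamma>) / 2 * v' x h)) (at x)" for x
        unfolding u_def[abs_def] by (intro has_derivative_diff has_derivative_mult_right b' v')
      have "?b (axis i 1) = \<beta> i" for i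
        by (simp add: weighted_sum_def axis_def if_distrib cong: if_cong)
      then have u_part: "partial_deriv i u x = (1 + \<gamma>) / 2 * \<beta> i - (1 - \<gamma>) / 2 * partial_deriv i v x" for i x
        by (simp add: partial_deriv_eq[OF u'] partial_deriv_eq[OF v'])
      have "\<gamma> * \<beta> i \<le> partial_deriv i u x \<and> partial_deriv i u x \<le> \<beta> i" for i x
      proof -
        have "(1 - \<gamma>) / 2 * \<bar>partial_deriv i v x\<bar> \<le> (1 - \<gamma>) / 2 * \<beta> i"
          using v_part[of i x] \<gamma> by (intro mult_left_mono) auto
        then have "\<bar>(1 - \<gamma>) / 2 * partial_deriv i v x\<bar> \<le> (1 - \<gamma>) / 2 * \<beta> i"
          using \<gamma> by (simp add: abs_mult)
        moreover have "(1 + \<gamma>) / 2 * \<beta> i + (1 - \<gamma>) / 2 * \<beta> i = \<beta> i"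
          "(1 + \<gamma>) / 2 * \<beta> i - (1 - \<gamma>) / 2 * \<beta> i = \<gamma> * \<beta> i"
          by (simp_all add: field_simps)
        moreover have "g \<le> p - t \<and> p - t \<le> b" if "\<bar>t\<bar> \<le> s" "p + s = b" "p - s = g" for b g p s t :: real
          using that by auto
        ultimately show ?thesis unfolding u_part by blast
      qed
      moreover have "u differentiable (at x)" for x using u' unfolding differentiable_def by blast
      ultimately have uPQ: "(LINT x:D|P. u x) \<le> (LINT x:D|Q. u x)" using masd unfolding MASD_def by blast
      note v_meas[measurable] = one_lipschitz_measurable[OF v_lip]
      note v_int = one_lipschitz_integrable_P[OF v_lip] one_lipschitz_integrable_Q[OF v_lip]
      note f_int = one_lipschitz_integrable_P[OF f_lip] one_lipschitz_integrable_Q[OF f_lip]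
      have "u \<in> borel_measurable borel" unfolding u_def[abs_def] by measurable
      with uPQ have "(LINT x|P. u x) \<le> (LINT x|Q. u x)" using setP setQ by metis
      moreover have "(LINT x|P. u x) = (1 + \<gamma>) / 2 * (LINT x|P. ?b x) - (1 - \<gamma>) / 2 * (LINT x|P. v x)"
        "(LINT x|Q. u x) = (1 + \<gamma>) / 2 * (LINT x|Q. ?b x) - (1 - \<gamma>) / 2 * (LINT x|Q. v x)"
        unfolding u_def using b_int v_int by simp_all
      ultimately have main: "(1 - \<gamma>) * ((LINT x|Q. v x) - (LINT x|P. v x)) \<le> (1 + \<gamma>) * \<Delta>"
        unfolding \<Delta> by (simp add: field_simps)
      have close: "min_cone A C x - \<epsilon> \<le> v x" "v x \<le> min_cone A C x + \<epsilon>" for x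
        using v_close[of x] by (auto simp: abs_le_iff)
      have "(LINT x|Q. min_cone A C x - \<epsilon>) \<le> (LINT x|Q. v x)"
        by (intro integral_mono Bochner_Integration.integrable_diff v_int f_int close) simp
      then have "(LINT x|Q. min_cone A C x) - \<epsilon> \<le> (LINT x|Q. v x)"
        using f_int by (simp add: Q.prob_space del: space_Q)
      moreover have "(LINT x|P. v x) \<le> (LINT x|P. min_cone A C x + \<epsilon>)"
        by (intro integral_mono Bochner_Integration.integrable_add v_int f_int close) simp
      then have "(LINT x|P. v x) \<le> (LINT x|P. min_cone A C x) + \<epsilon>"
        using f_int by (simp add: P.prob_space del: space_P)
      ultimately have "W - e \<le> (LINT x|Q. v x) - (LINT x|P. v x)"
        using WA by (simp add: \<epsilon>_def)
      then have "(1 - \<gamma>) * (W - e) \<le> (1 + \<gamma>) * \<Delta>"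
        using mult_left_mono[of "W - e" "(LINT x|Q. v x) - (LINT x|P. v x)" "1 - \<gamma>"] \<gamma> main by linarith
      moreover have "(1 - \<gamma>) * e \<le> e" using \<gamma> \<open>0 < e\<close> by (simp add: mult_le_cancel_right1)
      ultimately show "(1 - \<gamma>) * W \<le> (1 + \<gamma>) * \<Delta> + e" by (simp add: right_diff_distrib)
    qed
    show ?thesis using 1 2 3 by blast
  qed
  have "FOSD P Q \<longleftrightarrow> \<Delta> = W"
  proof
    assume fosd: "FOSD P Q"
    have "W \<le> \<Delta>"
    proof (rule field_le_epsilon)
      fix \<epsilon> :: real assume "0 < \<epsilon>"
      then obtain A C where A: "finite A" "A \<noteq> {}"
        and WA: "W \<le> (LINT y|Q. min_cone A C y) - (LINT x|P. min_cone A C x) + \<epsilon>"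
        using dual by blast
      have f_lip: "min_cone A C y - min_cone A C x \<le> ?c x y" for x y
        using A by (rule min_cone_one_lipschitz)
      note f_int = one_lipschitz_integrable_P[OF f_lip] one_lipschitz_integrable_Q[OF f_lip]
      \<comment> \<open>FOSD tests sublevel sets rather than functions, so \<open>min_cone\<close>
        enters unsmoothed: continuity of \<open>g\<close> makes them closed, monotonicity makes them
        lower sets. For \<open>x \<le> y\<close>, \<open>?b\<close> rises by exactly
        \<open>?c x y\<close>, and \<open>min_cone\<close> by no more than that.\<close>
      define g where "g x = ?b x - min_cone A C x" for x
      have g_mono: "g x \<le> g y" if "x \<le> y" for x y
        using f_lip[of y x] that l1_cost_eq_weighted_sum_iff[of \<beta> x y] \<beta> by (simp add: g_def)
      have g_cont: "continuous_on UNIV g"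
        unfolding g_def[abs_def]
        by (intro continuous_on_diff one_lipschitz_continuous[OF b_lip] one_lipschitz_continuous[OF f_lip])
      have "(LINT x|P. g x) \<le> (LINT x|Q. g x)"
      proof (rule integral_mono_cdf[OF prob_P prob_Q])
        show "sets P = sets Q" by (simp add: sets_P sets_Q)
        show "integrable P g" "integrable Q g" unfolding g_def using b_int f_int by auto
        fix t
        have "closed {x. g x \<le> t}"
          using g_cont by (intro closed_Collect_le continuous_on_const)
        moreover have "lower_set {x. g x \<le> t}"
          unfolding lower_set_def using g_mono order_trans by blast
        ultimately show "measure Q {x\<in>space Q. g x \<le> t} \<le> measure P {x\<in>space P. g x \<le> t}"
          using fosd by (simp add: FOSD_def)
      qed
      then have "(LINT y|Q. min_cone A C y) - (LINT x|P. min_cone A C x) \<le> \<Delta>"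
        unfolding g_def \<Delta> using b_int f_int by simp
      then show "W \<le> \<Delta> + \<epsilon>" using WA by simp
    qed
    with \<Delta>_le show "\<Delta> = W" by simp
  next
    assume "\<Delta> = W"
    note int = integrable_cost[OF \<kappa>0] \<Delta>\<kappa>(1)[OF \<kappa>0]
    have s[measurable_cong]: "sets \<kappa>0 = sets (borel \<Otimes>\<^sub>M borel)" using \<kappa>0 by (rule sets_coupling)
    interpret \<kappa>0: prob_space \<kappa>0 using \<kappa>0 by (rule prob_space_coupling)
    \<comment> \<open>A nonnegative function with integral \<open>W - \<Delta>\<close>. When this is
      0, it vanishes almost everywhere, and its zeros are the ordered pairs.\<close>
    let ?gap = "\<lambda>z. ?c (fst z) (snd z) - (?b (snd z) - ?b (fst z))"
    have "(LINT z|\<kappa>0. ?gap z) = 0"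
      using Bochner_Integration.integral_diff[OF int] \<Delta>\<kappa>(2)[OF \<kappa>0] \<open>\<Delta> = W\<close> by (simp add: W I_def)
    moreover have "integrable \<kappa>0 ?gap" using int by (rule Bochner_Integration.integrable_diff)
    moreover have "AE z in \<kappa>0. 0 \<le> ?gap z" using b_lip by (intro AE_I2) simp
    ultimately have "AE z in \<kappa>0. ?gap z = 0"
      using integral_nonneg_eq_0_iff_AE by blast
    then have ordered: "AE z in \<kappa>0. fst z \<le> snd z"
    proof eventually_elim
      case (elim z)
      then show ?case using l1_cost_eq_weighted_sum_iff[of \<beta> "fst z" "snd z"] \<beta> by simp
    qed
    show "FOSD P Q"
      unfolding FOSD_def
    proof (intro allI impI, elim conjE)
      fix A :: "(real^'n) set" assume "closed A" and low: "lower_set A"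
      then have A[measurable]: "A \<in> sets borel" by auto
      have "P = distr \<kappa>0 borel fst" "Q = distr \<kappa>0 borel snd" using \<kappa>0 by (auto simp: couplings_def)
      moreover have "fst \<in> \<kappa>0 \<rightarrow>\<^sub>M borel" "snd \<in> \<kappa>0 \<rightarrow>\<^sub>M borel" by measurable
      ultimately have "measure P A = measure \<kappa>0 (fst -` A \<inter> space \<kappa>0)" "measure Q A = measure \<kappa>0 (snd -` A \<inter> space \<kappa>0)"
        using A measure_distr by metis+
      moreover have "measure \<kappa>0 (snd -` A \<inter> space \<kappa>0) \<le> measure \<kappa>0 (fst -` A \<inter> space \<kappa>0)"
      proof (rule \<kappa>0.finite_measure_mono_AE)
        show "AE z in \<kappa>0. z \<in> snd -` A \<inter> space \<kappa>0 \<longrightarrow> z \<in> fst -` A \<inter> space \<kappa>0"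
          using ordered by eventually_elim (use low in \<open>auto simp: lower_set_def\<close>)
        show "fst -` A \<inter> space \<kappa>0 \<in> sets \<kappa>0" by measurable
      qed
      ultimately show "measure Q A \<le> measure P A" by simp
    qed
  qed
  with equiv show ?thesis unfolding \<Delta>_def W_def by blast
qed

end
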